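(* Let $R_1$ be the optimal expected rendezvous time of oblivious self-distance strategies for initial separation $2d=2$ (i.e. $d=1$), and let $U_{1,2}(a_1)$ be the expected absorption time of the level-$2$ truncated chain (for $d=1$) with parameter $a_1\in[0,1]$. Then $$R_1\approx 6.4670988308 .$$ Moreover, $R_1$ is attained by a level-$2$ truncated chain with parameter $a_1^\ast\approx 0.1992570042$, where $a_1^\ast$ is the unique root in $(0,1)$ of $$-12+52x+39x^2+12x^3-3x^4 .$$ Thus the exact value is $R_1=U_{1,2}(a_1^\ast)$.
   Context: Model. An admissible strategy is a sequence $a=(a_i)_{i\ge 0}$ with $a_i\in[0,1]$ and $a_0=\tfrac12$; $\mathcal A$ is the set of admissible strategies. Extend $a$ to a signed sequence $(b_i)_{i\in\mathbb Z}$ by $b_i=a_i$ for $i\ge0$ and $b_i=1-a_{-i}$ for $i<0$. Two independent Markov chains $(X_t)_{t\ge0},(Y_t)_{t\ge 0}$ on $\mathbb Z$ start at $X_0=Y_0=0$; each moves from $k$ to $k+1$ with probability $b_k$ and to $k-1$ with probability $1-b_k$. (These are the displacements of two agents from their starting points $-d$ and $d$.) For an integer $d\ge1$ the rendezvous time is $\mathcal T_d(a)=\inf\{t\ge0: X_t=Y_t+2d\}$, and $$R_d=\inf_{a\in\mathcal A}\mathbb E[\mathcal T_d(a)].$$ Truncated chain. Fix $d\ge1$, $n\ge d$ and $a=(a_1,\dots,a_{n-1})\in[0,1]^{n-1}$. Set $a_0=\frac12$, $a_i=0$ for $i\ge n$, and let $(b_i)$ be the signed sequence. The level-$n$ truncated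 chain has states $S_{x,y}$ with $-n\le x,y\le n$, $x-y\le 2d$, $x-y$ even; states with $x-y=2d$ are absorbing; from any other state $S_{x,y}$ the two coordinates move independently, $x\mapsto x+1$ with probability $b_x$ and $x\mapsto x-1$ otherwise, $y\mapsto y+1$ with probability $b_y$ and $y\mapsto y-1$ otherwise. $U_{d,n}(a)\in[0,\infty]$ is the expected hitting time of the absorbing set starting from $S_{0,0}$ ($\infty$ if not finite). The truncated chain with parameters $a$ is the rendezvous process of the admissible strategy $(\frac12,a_1,\dots,a_{n-1},0,0,\dots)$. The symbol $\approx$ denotes a numerical approximation, with no error tolerance specified; the exact content is the identity $R_1=U_{1,2}(a_1^\ast)$ with $a_1^\ast$ the stated root. *)

theory Defs
  imports "HOL-Probability.Probability"
begin

section \<open>Discrete-time Markov chains on a countable state space\<close>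

text \<open>
  A Markov chain with transition kernel \<open>K\<close> is driven by an i.i.d. sequence of random maps whose
  values at the states \<open>s\<close> are independent with law \<open>K s\<close>: at time \<open>t\<close> the chain moves from its
  current state \<open>s\<close> to the value at \<open>s\<close> of the \<open>t\<close>-th map.  \<open>markov_chain K s\<close> is the law of the
  trajectory \<open>(X\<^sub>t)\<close> with \<open>X\<^sub>0 = s\<close>; \<open>X\<^sub>t\<close> is \<open>\<omega> !! t\<close>.  Lemma \<open>emeasure_markov_chain_path\<close> below
  gives the probabilities of finite paths, which determine this law.
\<close>

primcorec walk :: "'s \<Rightarrow> ('s \<Rightarrow> 's) stream \<Rightarrow> 's stream" where
  "shd (walk s \<omega>) = s"
| "stl (walk s \<omega>) = walk (shd \<omega> s) (stl \<omega>)"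

definition random_maps :: "('s \<Rightarrow> 's pmf) \<Rightarrow> ('s \<Rightarrow> 's) measure" where
  "random_maps K = (\<Pi>\<^sub>M s\<in>UNIV. measure_pmf (K s))"

definition markov_chain :: "('s::countable \<Rightarrow> 's pmf) \<Rightarrow> 's \<Rightarrow> 's stream measure" where
  "markov_chain K s =
     distr (stream_space (random_maps K)) (stream_space (count_space UNIV)) (walk s)"

lemma prob_space_random_maps: "prob_space (random_maps K)"
  unfolding random_maps_def by (intro prob_space_PiM measure_pmf.prob_space_axioms)

lemma measurable_random_maps_component [measurable]:
  "(\<lambda>f. f s) \<in> random_maps K \<rightarrow>\<^sub>M count_space UNIV"
  unfolding random_maps_def using measurable_component_singleton[of s UNIV "\<lambda>s. measure_pmf (K s)"]
  by simp

lemma measurable_walk [measurable]: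
  fixes K :: "'s::countable \<Rightarrow> 's pmf"
  shows "walk s \<in> stream_space (random_maps K) \<rightarrow>\<^sub>M stream_space (count_space UNIV)"
proof (rule measurable_stream_space2)
  fix n show "(\<lambda>\<omega>. walk s \<omega> !! n) \<in> stream_space (random_maps K) \<rightarrow>\<^sub>M count_space UNIV"
  proof (induction n arbitrary: s)
    case (Suc n)
    note Suc[measurable]
    have "(\<lambda>\<omega>. walk (shd \<omega> s) (stl \<omega>) !! n) \<in> stream_space (random_maps K) \<rightarrow>\<^sub>M count_space UNIV"
      by (rule measurable_compose_countable[where g="\<lambda>\<omega>. shd \<omega> s"]) measurable
    then show ?case by simp
  qed simp
qed

lemma prob_space_markov_chain: "prob_space (markov_chain K s)"
  unfolding markov_chain_def
  by (intro prob_space.prob_space_distr measurable_walk prob_space.prob_space_stream_space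
        prob_space_random_maps)

lemma distr_random_maps_component:
  "distr (random_maps K) (count_space UNIV) (\<lambda>f. f s) = measure_pmf (K s)"
proof -
  interpret product_prob_space "\<lambda>s. measure_pmf (K s)" UNIV ..
  have "distr (random_maps K) (count_space UNIV) (\<lambda>f. f s)
      = distr (random_maps K) (measure_pmf (K s)) (\<lambda>f. f s)"
    by (intro distr_cong) auto
  then show ?thesis unfolding random_maps_def using PiM_component[of s] by simp
qed

lemma nn_integral_markov_chain:
  fixes K :: "'s::countable \<Rightarrow> 's pmf"
  assumes [measurable]: "f \<in> borel_measurable (stream_space (count_space UNIV))"
  shows "(\<integral>\<^sup>+\<omega>. f \<omega> \<partial>markov_chain K s) = (\<integral>\<^sup>+t. \<integral>\<^sup>+\<omega>. f (s ## \<omega>) \<partial>markov_chain K t \<partial>measure_pmf (K s))"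
proof -
  interpret M: prob_space "random_maps K" by (rule prob_space_random_maps)
  interpret S: prob_space "stream_space (random_maps K)" by (rule M.prob_space_stream_space)
  have walk_SCons: "walk s (g ## \<omega>) = s ## walk (g s) \<omega>" for g \<omega>
    by (subst stream.expand[of "walk s (g ## \<omega>)" "s ## walk (g s) \<omega>"]) auto
  have "(\<integral>\<^sup>+\<omega>. f \<omega> \<partial>markov_chain K s) = (\<integral>\<^sup>+\<omega>. f (walk s \<omega>) \<partial>stream_space (random_maps K))"
    unfolding markov_chain_def by (rule nn_integral_distr) measurable
  also have "\<dots> = (\<integral>\<^sup>+g. \<integral>\<^sup>+\<omega>. f (s ## walk (g s) \<omega>) \<partial>stream_space (random_maps K) \<partial>random_maps K)"
    by (subst M.nn_integral_stream_space) (auto simp: walk_SCons)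
  also have "\<dots> = (\<integral>\<^sup>+t. \<integral>\<^sup>+\<omega>. f (s ## walk t \<omega>) \<partial>stream_space (random_maps K)
                     \<partial>distr (random_maps K) (count_space UNIV) (\<lambda>f. f s))"
    by (subst nn_integral_distr) auto
  also have "\<dots> = (\<integral>\<^sup>+t. \<integral>\<^sup>+\<omega>. f (s ## \<omega>) \<partial>markov_chain K t \<partial>measure_pmf (K s))"
    unfolding distr_random_maps_component markov_chain_def
    by (intro nn_integral_cong nn_integral_distr[symmetric]) measurable
  finally show ?thesis .
qed

lemma all_le_Suc: "(\<forall>i\<le>Suc n. P i) \<longleftrightarrow> P 0 \<and> (\<forall>i\<le>n. P (Suc i))"
  by (auto simp: All_less_Suc2 simp flip: less_Suc_eq_le)

lemma emeasure_markov_chain_path: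
  fixes K :: "'s::countable \<Rightarrow> 's pmf"
  shows "emeasure (markov_chain K s) {\<omega>. \<forall>i\<le>n. \<omega> !! i = x i} =
           (if x 0 = s then ennreal (\<Prod>i<n. pmf (K (x i)) (x (Suc i))) else 0)"
proof (induction n arbitrary: s x)
  have path [measurable]:
    "{\<omega>. \<forall>i\<le>n. \<omega> !! i = x i} \<in> sets (stream_space (count_space UNIV))" for n and x :: "nat \<Rightarrow> 's"
  proof -
    have "{\<omega> \<in> space (stream_space (count_space (UNIV :: 's set))). \<forall>i\<in>{..n}. \<omega> !! i = x i}
            \<in> sets (stream_space (count_space UNIV))" by measurable
    then show ?thesis by (simp add: space_stream_space atMost_def)
  qed
  have path_mc [measurable]: "{\<omega>. \<forall>i\<le>n. \<omega> !! i = x i} \<in> sets (markov_chain K s)"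
    for n s and x :: "nat \<Rightarrow> 's"
    using path by (simp add: markov_chain_def)
  have rec: "emeasure (markov_chain K s) {\<omega>. \<forall>i\<le>n. \<omega> !! i = x i} =
      (\<integral>\<^sup>+t. \<integral>\<^sup>+\<omega>. indicator {\<omega>. \<forall>i\<le>n. \<omega> !! i = x i} (s ## \<omega>) \<partial>markov_chain K t \<partial>measure_pmf (K s))"
    for n s x
    by (subst nn_integral_markov_chain[symmetric]) (auto simp: path_mc)
  {
    case 0
    interpret M: prob_space "markov_chain K t" for t by (rule prob_space_markov_chain)
    show ?case
      by (subst rec) (simp add: indicator_def M.emeasure_space_1)
  next
    case (Suc n)
    let ?B = "{\<omega>. \<forall>i\<le>n. \<omega> !! i = x (Suc i)}"
    let ?c = "\<Prod>i<n. pmf (K (x (Suc i))) (x (Suc (Suc i)))"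
    have ind: "indicator {\<omega>. \<forall>i\<le>Suc n. \<omega> !! i = x i} (s ## \<omega>) = indicator {x 0} s * (indicator ?B \<omega> :: ennreal)"
      for \<omega>
      by (auto simp: indicator_def all_le_Suc)
    have "emeasure (markov_chain K s) {\<omega>. \<forall>i\<le>Suc n. \<omega> !! i = x i}
        = (\<integral>\<^sup>+t. indicator {x 0} s * emeasure (markov_chain K t) ?B \<partial>measure_pmf (K s))"
      unfolding rec[of s "Suc n"] ind
      by (intro nn_integral_cong) (subst nn_integral_cmult_indicator[OF path_mc], rule refl)
    also have "\<dots> = (\<integral>\<^sup>+t. (indicator {x 0} s * ennreal ?c) * indicator {x (Suc 0)} t \<partial>measure_pmf (K s))"
      by (intro nn_integral_cong) (subst Suc.IH, auto simp: indicator_def)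
    also have "\<dots> = indicator {x 0} s * ennreal ?c * ennreal (pmf (K s) (x (Suc 0)))"
      by (subst nn_integral_cmult) (auto simp: emeasure_pmf_single)
    also have "\<dots> = (if x 0 = s then ennreal (\<Prod>i<Suc n. pmf (K (x i)) (x (Suc i))) else 0)"
      by (auto simp: indicator_def prod.lessThan_Suc_shift ennreal_mult[symmetric] prod_nonneg mult.commute
            simp del: prod.lessThan_Suc)
    finally show ?case .
  }
qed

text \<open>The infimum over the empty set is \<open>\<infinity>\<close>.\<close>

definition first_time :: "(nat \<Rightarrow> bool) \<Rightarrow> ennreal" where
  "first_time P = (INF t\<in>{t. P t}. of_nat t)"


section \<open>Oblivious self-distance strategies and rendezvous\<close>

definition admissible :: "(nat \<Rightarrow> real) set" where
  "admissible = {a. a 0 = 1 / 2 \<and> (\<forall>i. 0 \<le> a i \<and> a i \<le> 1)}"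

definition signed_seq :: "(nat \<Rightarrow> real) \<Rightarrow> int \<Rightarrow> real" where
  "signed_seq a k = (if 0 \<le> k then a (nat k) else 1 - a (nat (- k)))"

definition agent_step :: "(nat \<Rightarrow> real) \<Rightarrow> int \<Rightarrow> int pmf" where
  "agent_step a k = map_pmf (\<lambda>up. if up then k + 1 else k - 1) (bernoulli_pmf (signed_seq a k))"

text \<open>\<open>X\<close> and \<open>Y\<close> are displacements, so both agents start at \<open>0\<close> and meet when \<open>X\<^sub>t = Y\<^sub>t + 2d\<close>.\<close>

definition expected_rendezvous_time :: "nat \<Rightarrow> (nat \<Rightarrow> real) \<Rightarrow> ennreal" where
  "expected_rendezvous_time d a =
     (\<integral>\<^sup>+(X, Y). first_time (\<lambda>t. X !! t = Y !! t + 2 * int d)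
        \<partial>(markov_chain (agent_step a) 0 \<Otimes>\<^sub>M markov_chain (agent_step a) 0))"

definition optimal_rendezvous_time :: "nat \<Rightarrow> ennreal" where
  "optimal_rendezvous_time d = (INF a\<in>admissible. expected_rendezvous_time d a)"


section \<open>The truncated chain\<close>

text \<open>The list \<open>as\<close> of length \<open>n - 1\<close> holds the parameters \<open>a\<^sub>1, \<dots>, a\<^sub>n\<^sub>-\<^sub>1\<close>.\<close>

definition trunc_strategy :: "nat \<Rightarrow> real list \<Rightarrow> nat \<Rightarrow> real" where
  "trunc_strategy n as i = (if i = 0 then 1 / 2 else if i < n then as ! (i - 1) else 0)"

text \<open>
  The kernel is defined on all pairs of integers; by \<open>trunc_step_closed\<close> the chain stays in
  \<open>trunc_states d n\<close> when started in \<open>(0, 0)\<close>.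
\<close>

definition trunc_states :: "nat \<Rightarrow> nat \<Rightarrow> (int \<times> int) set" where
  "trunc_states d n =
     {(x, y). \<bar>x\<bar> \<le> int n \<and> \<bar>y\<bar> \<le> int n \<and> x - y \<le> 2 * int d \<and> even (x - y)}"

definition trunc_step :: "nat \<Rightarrow> nat \<Rightarrow> real list \<Rightarrow> int \<times> int \<Rightarrow> (int \<times> int) pmf" where
  "trunc_step d n as = (\<lambda>(x, y).
     if x - y = 2 * int d then return_pmf (x, y)
     else pair_pmf (agent_step (trunc_strategy n as) x) (agent_step (trunc_strategy n as) y))"

definition trunc_absorption_time :: "nat \<Rightarrow> nat \<Rightarrow> real list \<Rightarrow> ennreal" where
  "trunc_absorption_time d n as =
     (\<integral>\<^sup>+\<omega>. first_time (\<lambda>t. fst (\<omega> !! t) - snd (\<omega> !! t) = 2 * int d)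
        \<partial>markov_chain (trunc_step d n as) (0, 0))"

lemma trunc_strategy_admissible:
  assumes "length as = n - 1" "set as \<subseteq> {0..1}"
  shows "trunc_strategy n as \<in> admissible"
proof -
  have "as ! (i - 1) \<in> {0..1}" if "i \<noteq> 0" "i < n" for i
    using that assms by (intro subsetD[OF assms(2)] nth_mem) auto
  then show ?thesis by (auto simp: admissible_def trunc_strategy_def)
qed

lemma agent_step_trunc_strategy_bounded:
  assumes "1 \<le> n" "\<bar>x\<bar> \<le> int n" "x' \<in> set_pmf (agent_step (trunc_strategy n as) x)"
  shows "\<bar>x'\<bar> \<le> int n" "\<bar>x' - x\<bar> = 1"
proof -
  have "signed_seq (trunc_strategy n as) (int n) = 0" "signed_seq (trunc_strategy n as) (- int n) = 1"
    using assms(1) by (auto simp: signed_seq_def trunc_strategy_def)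
  moreover have "True \<notin> set_pmf (bernoulli_pmf 0)" "False \<notin> set_pmf (bernoulli_pmf 1)"
    by (simp_all add: set_pmf_eq)
  ultimately have *: "x = int n \<Longrightarrow> x' = x - 1" "x = - int n \<Longrightarrow> x' = x + 1"
    using assms(3) by (auto simp: agent_step_def split: if_splits)
  have "x' = x + 1 \<or> x' = x - 1" using assms(3) by (auto simp: agent_step_def split: if_splits)
  with * assms(2) show "\<bar>x'\<bar> \<le> int n" "\<bar>x' - x\<bar> = 1" by linarith+
qed

lemma trunc_step_closed:
  assumes n: "1 \<le> n" and s: "s \<in> trunc_states d n" and s': "s' \<in> set_pmf (trunc_step d n as s)"
  shows "s' \<in> trunc_states d n"
proof (cases s; cases s')
  fix x y x' y' assume eq: "s = (x, y)" "s' = (x', y')"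
  show ?thesis
  proof (cases "x - y = 2 * int d")
    case True
    then show ?thesis using s s' eq by (simp add: trunc_step_def)
  next
    case False
    have x': "\<bar>x'\<bar> \<le> int n" "\<bar>x' - x\<bar> = 1" and y': "\<bar>y'\<bar> \<le> int n" "\<bar>y' - y\<bar> = 1"
      using agent_step_trunc_strategy_bounded[OF n, of x x' as]
        agent_step_trunc_strategy_bounded[OF n, of y y' as] False s s' eq
      by (auto simp: trunc_step_def trunc_states_def)
    have s_xy: "x - y \<le> 2 * int d" "even (x - y)" using s eq by (auto simp: trunc_states_def)
    then obtain k where "x - y = 2 * k" by (elim evenE)
    with s_xy False have "x - y \<le> 2 * int d - 2" by presburger
    moreover have "x' = x + 1 \<or> x' = x - 1" "y' = y + 1 \<or> y' = y - 1" using x' y' by linarith+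
    ultimately show ?thesis using x' y' s_xy eq by (auto simp: trunc_states_def)
  qed
qed

end

theory Submission
  imports Defs
begin

text \<open>
  Write \<open>h(x, y)\<close> for the expected meeting time from displacements \<open>(x, y)\<close> under a strategy with
  \<open>a\<^sub>1 = p\<close> and \<open>a\<^sub>2 = q\<close>.  Since the chains move to nearest neighbours, \<open>h\<close> is decreasing in \<open>x\<close> and
  increasing in \<open>y\<close> (in steps of 2), and \<open>h(k, k) \<ge> 4\<close> because two agents at equal displacements
  meet in the next step with probability at most \<open>1/4\<close>.  These facts bound \<open>h\<close> outside
  \<open>\<bar>x\<bar>, \<bar>y\<bar> \<le> 2\<close> well enough that the six balance equations inside imply either \<open>h(0, 0) \<ge> 13/2\<close> or
  \<open>h(0, 0) \<ge> N(p) / D(p)\<close>, the value at \<open>q = 0\<close>.  The derivative of \<open>N / D\<close> has the sign of the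
  quartic, so its root in \<open>(0, 1)\<close> minimises \<open>N / D\<close>; the minimum lies below \<open>13/2\<close>, and an
  explicit solution of the balance equations for \<open>q = 0\<close> shows that it is attained.
\<close>

section \<open>The rational function of the level-2 chain\<close>

definition trunc_num :: "real \<Rightarrow> real" where
  "trunc_num p = 14 + 9 * p - 2 * p^2 + p^3"
definition trunc_den :: "real \<Rightarrow> real" where
  "trunc_den p = (1 - p) * (2 + 5 * p + p^2)"
text \<open>With N = \<open>trunc_num\<close> and D = \<open>trunc_den\<close>, this is (N' D - N
  D') / 2, hence its link to the derivative of N / D.\<close>

definition crit :: "real \<Rightarrow> real" where
  "crit x = - 12 + 52 * x + 39 * x^2 + 12 * x^3 - 3 * x^4"

lemma trunc_den_pos: "0 \<le> p \<Longrightarrow> p < 1 \<Longrightarrow> trunc_den p > 0"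
  unfolding trunc_den_def by (intro mult_pos_pos add_pos_nonneg) auto

text \<open>On [0, 1] the divided difference is at least 52 - 12, since only the quartic term
  contributes negatively. This makes the root unique.\<close>

lemma crit_mono:
  assumes "0 \<le> x" "x < y" "y \<le> 1"
  shows "crit x < crit y"
proof -
  have diff: "crit y - crit x = (y - x) * (52 + 39 * (x + y) + 12 * (x^2 + x*y + y^2) - 3 * ((x + y) * (x^2 + y^2)))"
    unfolding crit_def by algebra
  have "(x + y) * (x^2 + y^2) \<le> 2 * 2"
    using assms power_le_one[of x 2] power_le_one[of y 2] by (intro mult_mono) auto
  moreover have "52 + 39 * u + 12 * v - 3 * w > 0" if "0 \<le> u" "0 \<le> v" "w \<le> 2 * 2" for u v w :: real
    using that by linarith
  moreover have "0 \<le> x + y" "0 \<le> x^2 + x * y + y^2" using assms by simp_all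
  ultimately have "52 + 39 * (x + y) + 12 * (x^2 + x*y + y^2) - 3 * ((x + y) * (x^2 + y^2)) > 0"
    by blast
  with assms have "(y - x) * (52 + 39 * (x + y) + 12 * (x^2 + x*y + y^2) - 3 * ((x + y) * (x^2 + y^2))) > 0"
    by (intro mult_pos_pos) auto
  with diff show ?thesis by linarith
qed

lemma crit_root:
  obtains s where "{x \<in> {0<..<1}. crit x = 0} = {s}" "\<bar>s - 0.1992570042\<bar> \<le> 0.00000000005"
proof -
  let ?l = "0.19925700415 :: real" and ?u = "0.19925700425 :: real"
  have "\<exists>s\<ge>?l. s \<le> ?u \<and> crit s = 0"
  proof (rule IVT')
    show "continuous_on {?l..?u} crit" unfolding crit_def by (intro continuous_intros)
  qed (simp_all add: crit_def power_divide)
  then obtain s where s: "?l \<le> s" "s \<le> ?u" "crit s = 0" by blast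
  have "x = s" if "0 < x" "x < 1" "crit x = 0" for x
    using that s crit_mono[of x s] crit_mono[of s x] by (cases x s rule: linorder_cases) auto
  with s have "{x \<in> {0<..<1}. crit x = 0} = {s}" by auto
  moreover have "\<bar>s - 0.1992570042\<bar> \<le> 0.00000000005" using s by (auto simp: abs_real_def)
  ultimately show ?thesis using that by blast
qed

text \<open>Expand the cross-multiplied difference around s: the linear part carries the factor
  \<open>crit s\<close>, which vanishes, and the cofactor of (p - s)^2 is nonnegative on the unit
  interval.\<close>

lemma trunc_ratio_minimal:
  assumes s: "0 \<le> s" "s < 1" "crit s = 0" and p: "0 \<le> p" "p < 1"
  shows "trunc_num s / trunc_den s \<le> trunc_num p / trunc_den p"
proof -
  have "trunc_num p * trunc_den s - trunc_num s * trunc_den p =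
    (p - s)^2 * (52 + 62 * s + 16 * p + 24 * s^2 + 12 * p * s - 6 * s^3 - 6 * p * s^2) + (p - s) * (2 * crit s)"
    unfolding trunc_num_def trunc_den_def crit_def by algebra
  moreover have "0 \<le> 52 + 62 * s + 16 * p + 24 * s^2 + 12 * p * s - 6 * s^3 - 6 * p * s^2"
  proof -
    have "s^3 \<le> 1" "p * s^2 \<le> 1" "0 \<le> p * s" "0 \<le> s^2"
      using s p by (auto intro!: power_le_one mult_le_one)
    then show ?thesis using s p by linarith
  qed
  ultimately have "0 \<le> trunc_num p * trunc_den s - trunc_num s * trunc_den p"
    using s(3) by simp
  then show ?thesis
    using s p trunc_den_pos by (simp add: field_simps)
qed

text \<open>For each endpoint v of the rounding interval, the sign of N - v D is computed at the
  decimal c and transferred to s.\<close>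

lemma trunc_ratio_numeric:
  assumes "\<bar>s - 0.1992570042\<bar> \<le> 0.00000000005"
  shows "\<bar>trunc_num s / trunc_den s - 6.4670988308\<bar> \<le> 0.00000000005"
proof -
  define c :: real where "c = 0.1992570042"
  define t where "t = s - c"
  have s: "s = c + t" and t: "\<bar>t\<bar> \<le> 1 / 20000000000" using assms by (simp_all add: t_def c_def)
  have abs_mult_le: "\<bar>x * y\<bar> \<le> a * b" if "\<bar>x\<bar> \<le> a" "\<bar>y\<bar> \<le> b" for x y a b :: real
    unfolding abs_mult using that by (intro mult_mono) auto
  have t2: "\<bar>t^2\<bar> \<le> (1 / 20000000000)^2" "\<bar>t^3\<bar> \<le> (1 / 20000000000)^3"
    using t power_mono[OF t, of 2] power_mono[OF t, of 3] by (auto simp only: power_abs abs_ge_zero power2_abs zero_le_power2)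
  have pos: "trunc_den s > 0"
    using t by (intro trunc_den_pos) (auto simp: s c_def abs_le_iff)
  have expand: "trunc_num s - v * trunc_den s = (trunc_num c - v * trunc_den c)
      + (9 - 3 * v + 2 * (4 * v - 2) * c + 3 * (1 + v) * c^2) * t
      + (4 * v - 2 + 3 * (1 + v) * c) * t^2 + (1 + v) * t^3" for v
    unfolding s trunc_num_def trunc_den_def by algebra
  have *: "\<bar>trunc_num s - v * trunc_den s - (trunc_num c - v * trunc_den c)\<bar> \<le> 1 / 10^15"
    if v: "v = 6.46709883085 \<or> v = 6.46709883075" for v
  proof -
    \<comment> \<open>This is N'(c) - v D'(c). It nearly vanishes because c is almost critical and v
      almost equals N(c) / D(c).\<close>
    have 1: "\<bar>9 - 3 * v + 2 * (4 * v - 2) * c + 3 * (1 + v) * c^2\<bar> \<le> 1 / 10^6"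
      using v unfolding c_def by (elim disjE; hypsubst; simp add: power_divide)
    have 2: "\<bar>4 * v - 2 + 3 * (1 + v) * c\<bar> \<le> 30" and 3: "\<bar>1 + v\<bar> \<le> 8"
      using v unfolding c_def by (elim disjE; hypsubst; simp)+
    have "\<bar>x + y + z\<bar> \<le> 1 / 10^15"
      if "\<bar>x\<bar> \<le> 1 / 10^6 * (1 / 20000000000)" "\<bar>y\<bar> \<le> 30 * (1 / 20000000000)^2"
        "\<bar>z\<bar> \<le> 8 * (1 / 20000000000)^3" for x y z :: real
      using that abs_triangle_ineq[of "x + y" z] abs_triangle_ineq[of x y] by (simp add: power_divide)
    from this[OF abs_mult_le[OF 1 t] abs_mult_le[OF 2 t2(1)] abs_mult_le[OF 3 t2(2)]]
    show ?thesis unfolding expand by (simp add: algebra_simps)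
  qed
  \<comment> \<open>A perturbation of 10^-15 cannot reverse a sign that holds with margin
    10^-11.\<close>
  have near: "b \<le> - 1 / 100000000000 \<Longrightarrow> a \<le> 0" "1 / 100000000000 \<le> b \<Longrightarrow> 0 \<le> a"
    if "\<bar>a - b\<bar> \<le> 1 / 10^15" for a b :: real
    using abs_le_D1[OF that] abs_le_D2[OF that] by simp_all
  have horner: "trunc_num c - v * trunc_den c = 14 + c * (9 + c * (-2 + c)) - v * (2 + c * (3 + c * (-4 - c)))" for v
    unfolding trunc_num_def trunc_den_def by algebra
  have "trunc_num c - 6.46709883085 * trunc_den c \<le> - 1 / 100000000000"
    unfolding horner by (simp add: c_def)
  then have "trunc_num s - 6.46709883085 * trunc_den s \<le> 0"
    using near(1)[OF *[of "6.46709883085"]] by blast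
  moreover have "trunc_num c - 6.46709883075 * trunc_den c \<ge> 1 / 100000000000"
    unfolding horner by (simp add: c_def)
  then have "trunc_num s - 6.46709883075 * trunc_den s \<ge> 0"
    using near(2)[OF *[of "6.46709883075"]] by blast
  ultimately have "6.46709883075 \<le> trunc_num s / trunc_den s" "trunc_num s / trunc_den s \<le> 6.46709883085"
    using pos by (simp_all only: pos_le_divide_eq pos_divide_le_eq)
  moreover have "\<bar>r - 6.4670988308\<bar> \<le> 0.00000000005"
    if "6.46709883075 \<le> r" "r \<le> 6.46709883085" for r :: real
    using that by (auto simp: abs_real_def)
  ultimately show ?thesis by blast
qed

section \<open>Consequences of the balance equations\<close>

text \<open>For p at most 1/3 the gain pays for the loss: this is the comparison arising from
  \<open>balance_inequality\<close>, divided by 2 p. The constant 22/3 is the bound on B implied by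
  A < 13/2.\<close>

lemma small_p_impossible:
  fixes p q e :: real
  assumes p: "0 < p" "p \<le> 1 / 3" and q: "0 < q" "q \<le> 1"
    and e: "e \<le> q * (22 / 3 - 4 * q)"
  shows "p * (2 + p) * e \<le> 2 * (1 - p^2) * q * (4 - p * e)"
proof -
  define w where "w = 22 / 3 - 4 * q"
  have w: "0 < w" using q by (simp add: w_def)
  have p2: "p^2 \<le> (1/3)^2" using p by (intro power_mono) auto
  have p2': "p^2 < 1" using p2 by (simp add: power2_eq_square)
  \<comment> \<open>The worst case p = 1/3 is inserted on both sides, which leaves a quadratic in
    q.\<close>
  have "p * (2 + p) \<le> 1 / 3 * (2 + 1 / 3)" using p by (intro mult_mono) auto
  then have "p * (2 + p) * w \<le> 7 / 9 * w" using w by (intro mult_right_mono) auto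
  also have "7 / 9 * w \<le> 16 / 9 * (4 - 1 / 3 * (q * w))"
  proof -
    have "64 - w * (7 + 16 * q / 3) = 64 / 3 * (q - 25 / 96)^2 + (64 - 154 / 3 - 625 / 432)"
      unfolding w_def by (simp add: power2_eq_square algebra_simps)
    also have "\<dots> \<ge> 0" by (intro add_nonneg_nonneg) auto
    finally show ?thesis by (simp add: algebra_simps)
  qed
  also have "\<dots> \<le> 2 * (1 - p^2) * (4 - p * (q * w))"
  proof (intro mult_mono)
    show "16 / 9 \<le> 2 * (1 - p^2)" using p2 by (simp add: power2_eq_square)
    have "p * (q * w) \<le> 1 / 3 * (q * w)" using p q w by (intro mult_right_mono) auto
    then show "4 - 1 / 3 * (q * w) \<le> 4 - p * (q * w)" by linarith
    have "q * w \<le> 1 * (22 / 3)" using q w by (intro mult_mono) (auto simp: w_def)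
    then show "0 \<le> 4 - 1 / 3 * (q * w)" by simp
  qed (use p2' in auto)
  finally have *: "q * (p * (2 + p) * w) \<le> q * (2 * (1 - p^2) * (4 - p * (q * w)))"
    using q by (intro mult_left_mono) auto
  \<comment> \<open>Collected on one side, e has a nonnegative coefficient, so its upper bound q w
    is the worst case.\<close>
  have "p * (2 + p) * e + 2 * (1 - p^2) * q * (p * e) = (p * (2 + p) + 2 * (1 - p^2) * q * p) * e"
    by (simp add: algebra_simps)
  also have "\<dots> \<le> (p * (2 + p) + 2 * (1 - p^2) * q * p) * (q * w)"
    using e p q p2' unfolding w_def[symmetric] by (intro mult_left_mono add_nonneg_nonneg mult_nonneg_nonneg) auto
  finally show ?thesis using * by (simp add: algebra_simps)
qed

text \<open>This is l^2 < 4 a c for the quadratic a t^2 - l t + c in t = p q that appears in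
  \<open>large_p_impossible\<close>.\<close>

lemma discriminant_neg:
  fixes p :: real
  assumes "1 / 3 \<le> p" "p \<le> 1"
  shows "(44 / 3 * p * (2 + p) - (1 - p^2) * (16 - 27 / 2 * p))^2
      < 32 * (2 + p) * (1 - 21 / 2 * p + 24 * p^2 + 15 / 2 * p^3)"
proof -
  define u v where "u = p - 1 / 3" and "v = 1 - p"
  have uv: "0 \<le> u" "0 \<le> v" "0 < u + v" and p: "p = 1 / 3 + u" "v = 2 / 3 - u"
    using assms by (simp_all add: u_def v_def)
  \<comment> \<open>Bernstein expansion on \<open>[1/3, 1]\<close>\<close>
  have "32 * (2 + p) * (1 - 21 / 2 * p + 24 * p^2 + 15 / 2 * p^3)
      - (44 / 3 * p * (2 + p) - (1 - p^2) * (16 - 27 / 2 * p))^2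
    = 362 * v^6 + 5758 * u * v^5 + 301871 / 16 * u^2 * v^4 + 189735 / 8 * u^3 * v^3
      + 216747 / 16 * u^4 * v^2 + 21951 / 4 * u^5 * v + 8019 / 4 * u^6"
    unfolding p by algebra
  also have "\<dots> > 0"
  proof (cases "u = 0")
    case False
    with uv show ?thesis by (intro add_nonneg_pos add_nonneg_nonneg) auto
  qed (use uv in auto)
  finally show ?thesis by simp
qed

text \<open>For p at least 1/3 the loss may exceed the gain, but N / D then has enough room above
  13/2 to absorb it. With e at its worst, the remaining margin is bounded below by a quadratic in p
  q without real roots.\<close>

lemma large_p_impossible:
  fixes p q e :: real
  assumes p: "1 / 3 \<le> p" "p < 1" and q: "0 \<le> q" "q \<le> 1"
    and e: "e \<le> q * (22 / 3 - 4 * q)"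
  shows "2 * p^2 * (2 + p) * e < 14 + 9 * p - 2 * p^2 + p^3 - 13 / 2 * trunc_den p + 4 * p * (1 - p^2) * q * (4 - p * e)"
proof -
  define w where "w = 22 / 3 - 4 * q"
  define c where "c = 1 - 21 / 2 * p + 24 * p^2 + 15 / 2 * p^3"
  define a where "a = 8 * (2 + p)"
  define l where "l = 44 / 3 * p * (2 + p) - (1 - p^2) * (16 - 27 / 2 * p)"
  have p2: "p^2 < 1" using p by (simp add: power_less_one_iff abs_square_less_1)
  have e': "e \<le> q * w" using e by (simp add: w_def)
  \<comment> \<open>The maximum of q w is 121/36, at q = 11/12; 27/8 lies just above it.\<close>
  have qw: "q * w \<le> 27 / 8"
  proof -
    have "27 / 8 - q * w = (2 * q - 11 / 6)^2 + (27 / 8 - 121 / 36)"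
      unfolding w_def by (simp add: power2_eq_square algebra_simps)
    also have "\<dots> \<ge> 0" by (intro add_nonneg_nonneg) auto
    finally show ?thesis by simp
  qed
  have "2 * p^2 * (2 + p) * e + 4 * p * (1 - p^2) * q * (p * e)
      = (2 * p^2 * (2 + p) + 4 * p * (1 - p^2) * q * p) * e"
    by (simp add: algebra_simps)
  also have "\<dots> \<le> (2 * p^2 * (2 + p) + 4 * p * (1 - p^2) * q * p) * (q * w)"
    using e' p q p2 by (intro mult_left_mono add_nonneg_nonneg mult_nonneg_nonneg) auto
  also have "\<dots> = 2 * p^2 * (2 + p) * (q * w) + 4 * p^2 * (1 - p^2) * q * (q * w)"
    by (simp add: algebra_simps power2_eq_square)
  \<comment> \<open>Only the term cubic in q is coarsened, so that the whole expression becomes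
    quadratic in q.\<close>
  also have "\<dots> \<le> 2 * p^2 * (2 + p) * (q * w) + 4 * p^2 * (1 - p^2) * q * (27 / 8)"
    using qw p q p2 by (intro add_left_mono mult_left_mono mult_nonneg_nonneg) auto
  finally have upper: "2 * p^2 * (2 + p) * e + 4 * p * (1 - p^2) * q * (p * e)
      \<le> 2 * p^2 * (2 + p) * (q * w) + 4 * p^2 * (1 - p^2) * q * (27 / 8)" .
  have quad: "0 < a * (p * q)^2 - l * (p * q) + c"
  proof -
    have a: "a > 0" using p by (simp add: a_def)
    have "l^2 < 4 * a * c"
      using discriminant_neg[of p] p unfolding a_def c_def l_def by simp
    moreover have "4 * a * (a * (p * q)^2 - l * (p * q) + c) = (2 * a * (p * q) - l)^2 + (4 * a * c - l^2)"
      by (simp add: power2_eq_square algebra_simps)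
    ultimately have "0 < 4 * a * (a * (p * q)^2 - l * (p * q) + c)"
      by (metis add_nonneg_pos diff_gt_0_iff_gt zero_le_power2)
    with a show ?thesis by (simp add: zero_less_mult_iff)
  qed
  have "14 + 9 * p - 2 * p^2 + p^3 - 13 / 2 * trunc_den p + 16 * p * (1 - p^2) * q
      - (2 * p^2 * (2 + p) * (q * w) + 4 * p^2 * (1 - p^2) * q * (27 / 8))
    = a * (p * q)^2 - l * (p * q) + c"
    unfolding a_def l_def c_def w_def trunc_den_def by algebra
  with quad upper show ?thesis by (simp add: algebra_simps)
qed

text \<open>
  In the next lemmas \<open>A, \<dots>, I\<close> stand for \<open>h\<close> at \<open>(0,0)\<close>, \<open>(1,1)\<close>, \<open>(-1,1)\<close>, \<open>(0,2)\<close>, \<open>(2,2)\<close>,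
  \<open>(-2,2)\<close>, \<open>(1,3)\<close>, \<open>(-1,3)\<close>, \<open>(3,3)\<close>.  A strategy with \<open>q > 0\<close> raises \<open>D\<close> by \<open>g\<close> and lowers \<open>E\<close>
  by \<open>e\<close> relative to the balance equations for \<open>q = 0\<close>, so the question is whether the loss outweighs the gain.
\<close>

lemma balance_inequality:
  fixes A B C D E F e g p :: real
  assumes p: "0 < p" "p < 1"
    and A: "A = 1 + C / 4 + B / 2"
    and B: "B \<ge> 1 + p * (1 - p) * D + p^2 * E + (1 - p)^2 * A"
    and C: "C \<ge> 1 + (1 - p)^2 * A + p^2 * F + 2 * p * (1 - p) * D"
    and D: "D \<ge> 1 + (B + C) / 2 + g" and E: "E \<ge> 1 + B - e" and F: "F \<ge> 1 + C"
  shows "trunc_num p + 8 * p * (1 - p^2) * g \<le> trunc_den p * A + 2 * p^2 * (2 + p) * e"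
proof -
  have p2: "p^2 < 1" using p by (simp add: power_less_one_iff abs_square_less_1)
  have EF: "p^2 * (1 + B - e) \<le> p^2 * E" "p^2 * (1 + C) \<le> p^2 * F"
    using E F by (auto intro!: mult_left_mono)
  have "(1 - p^2) * (2 + B + C + 2 * g) \<le> (1 - p^2) * (2 * D)"
    using D p2 by (intro mult_left_mono) (auto simp: field_simps)
  \<comment> \<open>Adding the bounds for B and C and eliminating B + C through D leaves a lower
    bound for D in terms of A.\<close>
  with B C EF have 1: "p * (4 + 2 * (1 - p)^2 * A + 2 * (1 - p^2) * g - p^2 * e)
      \<le> p * ((1 - p) * (2 - p) * D)"
    using p by (intro mult_left_mono) (simp_all add: power2_eq_square algebra_simps)
  \<comment> \<open>The combination 2 B + C equals 4 A - 4, so weighting the bounds for B and C by 2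
    and 1 gives a relation between A and D alone.\<close>
  have eq: "4 * A - 1 - 2 * e = 2 * (1 + B - e) + (1 + C)" using A by simp
  have "p^2 * (4 * A - 1 - 2 * e) = 2 * (p^2 * (1 + B - e)) + p^2 * (1 + C)"
    unfolding eq by (simp add: algebra_simps)
  with EF have "p^2 * (4 * A - 1 - 2 * e) \<le> 2 * (p^2 * E) + p^2 * F" by linarith
  moreover have "4 * A = 4 + 2 * B + C" using A by simp
  ultimately have "(7 - p^2) + 4 * p * (1 - p) * D - 2 * p^2 * e \<le> (1 - p) * (1 + 7 * p) * A"
    using B C by (simp add: power2_eq_square algebra_simps)
  \<comment> \<open>The factor 2 - p matches the coefficient of D in \<open>1\<close>, so D can be
    eliminated.\<close>
  then have "(2 - p) * ((7 - p^2) + 4 * p * (1 - p) * D - 2 * p^2 * e)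
      \<le> (2 - p) * ((1 - p) * (1 + 7 * p) * A)"
    using p by (intro mult_left_mono) auto
  with 1 show ?thesis
    unfolding trunc_num_def trunc_den_def by (simp add: power2_eq_square power3_eq_cube algebra_simps)
qed

text \<open>If both alternatives fail, \<open>balance_inequality\<close> is contradicted: for p at
  most 1/3 the gain beats the loss, for larger p the value 13/2 is exceeded, and for q = 0 there is
  no loss.\<close>

lemma rendezvous_lower_bound:
  fixes A B C D E F e g p q :: real
  assumes p: "0 < p" "p < 1" and q: "0 \<le> q" "q \<le> 1"
    and A: "A = 1 + C / 4 + B / 2"
    and B: "B \<ge> 1 + p * (1 - p) * D + p^2 * E + (1 - p)^2 * A"
    and C: "C \<ge> 1 + (1 - p)^2 * A + p^2 * F + 2 * p * (1 - p) * D"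
    and D: "D \<ge> 1 + (B + C) / 2 + g" and E: "E \<ge> 1 + B - e" and F: "F \<ge> 1 + C"
    and BC: "B \<le> C"
    and e: "e \<le> q * (B - 4 * q)" and g: "g \<ge> q / 2 * (4 - p * e)"
  shows "trunc_num p / trunc_den p \<le> A \<or> 13 / 2 \<le> A"
proof (rule ccontr)
  assume "\<not> ?thesis"
  then have A1: "trunc_den p * A < trunc_num p" and A2: "A < 13 / 2"
    using trunc_den_pos[of p] p by (auto simp: field_simps)
  \<comment> \<open>Since B \<le> C, A is at least 1 + 3 B / 4.\<close>
  have "B < 22 / 3" using A A2 BC by simp
  then have "q * (B - 4 * q) \<le> q * (22 / 3 - 4 * q)" using q by (intro mult_left_mono) auto
  with e have e': "e \<le> q * (22 / 3 - 4 * q)" by simp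
  note bal = balance_inequality[OF p A B C D E F]
  have p2: "0 < 1 - p^2" using p by (simp add: power_less_one_iff abs_square_less_1)
  have g': "8 * p * (1 - p^2) * (q / 2 * (4 - p * e)) \<le> 8 * p * (1 - p^2) * g"
    using p p2 g by (intro mult_left_mono) auto
  show False
  proof (cases "p \<le> 1 / 3 \<and> q > 0")
    case True
    then have "2 * p * (p * (2 + p) * e) \<le> 2 * p * (2 * (1 - p^2) * q * (4 - p * e))"
      using small_p_impossible[of p q e] p q e' by (intro mult_left_mono) auto
    with bal g' A1 show False by (simp add: power2_eq_square algebra_simps)
  next
    case False
    show False
    proof (cases "q = 0")
      case True
      with g' have "0 \<le> 8 * p * (1 - p^2) * g" by simp
      with bal A1 have "0 < 2 * p^2 * (2 + p) * e" by linarith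
      moreover have "2 * p^2 * (2 + p) * e \<le> 2 * p^2 * (2 + p) * 0"
        using e' True p by (intro mult_left_mono) auto
      ultimately show False by simp
    next
      assume "q \<noteq> 0"
      with False q have "1 / 3 \<le> p" by auto
      from large_p_impossible[OF this p(2) q e'] bal g'
      have "13 / 2 * trunc_den p < trunc_den p * A" by (simp add: trunc_num_def algebra_simps)
      with A2 trunc_den_pos[of p] p show False by (simp add: mult.commute)
    qed
  qed
qed

text \<open>This supplies the bounds on e and g for \<open>rendezvous_lower_bound\<close>. For e, G
  and I are lowered to B and 4. For g, a first crude bound on D is fed back into the bounds for G
  and H.\<close>

lemma outer_correction_bounds:
  fixes B C D E F G H I p q :: real
  assumes p: "0 \<le> p" "p \<le> 1" and q: "0 \<le> q" "q \<le> 1"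
    and D: "D = 1 + (1 - q) / 2 * (B + C) + q / 2 * (G + H)"
    and E: "E = 1 + (1 - q)^2 * B + q * (1 - q) * G + q^2 * I"
    and F: "1 + C \<le> F" and I: "4 \<le> I"
    and G: "B \<le> G" "1 + p * E + (1 - p) * D \<le> G"
    and H: "C \<le> H" "1 + (1 - p) * D + p * F \<le> H"
  shows "1 + B - E \<le> q * (B - 4 * q)" (is ?e)
    and "q / 2 * (4 - p * (1 + B - E)) \<le> D - 1 - (B + C) / 2" (is ?g)
proof -
  have "0 \<le> q * (1 - q) * (G - B)" "0 \<le> q^2 * (I - 4)" using q G I by auto
  then show ?e unfolding E by (simp add: power2_eq_square algebra_simps)
  have g: "D - 1 - (B + C) / 2 = q / 2 * ((G - B) + (H - C))" unfolding D by (simp add: field_simps)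
  have "0 \<le> q / 2 * ((G - B) + (H - C))" using q G H by (intro mult_nonneg_nonneg) auto
  then have "1 + (B + C) / 2 \<le> D" using g by linarith
  then have "(1 - p) * (2 + B + C) \<le> (1 - p) * (2 * D)" using p by (intro mult_left_mono) (auto simp: field_simps)
  moreover have "p * (1 + C) \<le> p * F" using F p by (intro mult_left_mono) auto
  ultimately have "4 - p * (1 + B - E) \<le> (G - B) + (H - C)" using G H by (simp add: algebra_simps)
  then show ?g unfolding g using q by (intro mult_left_mono) auto
qed

section \<open>Meeting times by value iteration\<close>

\<comment> \<open>This rule also matches function application in general and leads the measurability prover astray.\<close>
declare measurable_random_maps_component [measurable del]

text \<open>The minimum of n and the first time, written by shifting the predicate so that it
  unfolds along with one step of a chain.\<close>

primrec capped_time :: "nat \<Rightarrow> (nat \<Rightarrow> bool) \<Rightarrow> ennreal" where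
  "capped_time 0 P = 0"
| "capped_time (Suc n) P = (if P 0 then 0 else 1 + capped_time n (\<lambda>t. P (Suc t)))"

lemma capped_time_never: "(\<And>t. \<not> P t) \<Longrightarrow> capped_time n P = of_nat n"
  by (induction n arbitrary: P) auto

lemma capped_time_hit: "P T \<Longrightarrow> (\<And>t. t < T \<Longrightarrow> \<not> P t) \<Longrightarrow> capped_time n P = of_nat (min n T)"
proof (induction n arbitrary: P T)
  case (Suc n)
  show ?case
  proof (cases T)
    case (Suc T')
    then have "capped_time n (\<lambda>t. P (Suc t)) = of_nat (min n T')"
      using Suc.prems by (intro Suc.IH) auto
    with Suc Suc.prems show ?thesis by simp
  qed (use Suc.prems in auto)
qed simp

lemma incseq_capped_time: "incseq (\<lambda>n. capped_time n P)"
proof (cases "\<exists>t. P t")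
  case True
  have "capped_time n P = of_nat (min n (LEAST t. P t))" for n
    by (rule capped_time_hit[of P "LEAST t. P t"]) (use LeastI_ex[OF True] not_less_Least in blast)+
  then show ?thesis by (auto simp: incseq_def)
qed (auto simp: capped_time_never incseq_def)

lemma SUP_capped_time: "(SUP n. capped_time n P) = first_time P"
proof (cases "\<exists>t. P t")
  case True
  define T where "T = (LEAST t. P t)"
  have T: "P T" using True unfolding T_def by (rule LeastI_ex)
  have T_le: "T \<le> t" if "P t" for t using that unfolding T_def by (rule Least_le)
  have "first_time P = of_nat T"
    unfolding first_time_def by (intro antisym INF_lower INF_greatest) (auto simp: T T_le)
  moreover have "(SUP n. capped_time n P) = of_nat T"
  proof (rule antisym)
    have cap: "capped_time n P = of_nat (min n T)" for n
      using T by (rule capped_time_hit) (use T_le in force)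
    show "(SUP n. capped_time n P) \<le> of_nat T" by (intro SUP_least) (simp add: cap)
    show "of_nat T \<le> (SUP n. capped_time n P)" by (intro SUP_upper2[of T]) (auto simp: cap)
  qed
  ultimately show ?thesis by simp
next
  case False
  then show ?thesis by (simp add: capped_time_never first_time_def ennreal_SUP_of_nat_eq_top)
qed

lemma measurable_capped_time [measurable]:
  assumes "\<And>t. Measurable.pred M (\<lambda>x. P x t)"
  shows "(\<lambda>x. capped_time n (P x)) \<in> borel_measurable M"
  using assms
proof (induction n arbitrary: P)
  case (Suc n)
  note Suc.prems[measurable] Suc.IH[OF Suc.prems, measurable]
  show ?case by simp
qed simp

text \<open>Monotone convergence reduces the expectation to finite horizons, which obey a
  recursion.\<close>

lemma nn_integral_first_time:
  assumes "\<And>t. Measurable.pred M (\<lambda>x. P x t)"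
  shows "(\<integral>\<^sup>+x. first_time (P x) \<partial>M) = (SUP n. \<integral>\<^sup>+x. capped_time n (P x) \<partial>M)"
  unfolding SUP_capped_time[symmetric] using incseq_capped_time assms
  by (intro nn_integral_monotone_convergence_SUP measurable_capped_time) (auto simp: incseq_def le_fun_def)

section \<open>Value iteration for two independent walkers\<close>

definition pair_step :: "(int \<Rightarrow> real) \<Rightarrow> (int \<Rightarrow> int \<Rightarrow> ennreal) \<Rightarrow> int \<Rightarrow> int \<Rightarrow> ennreal" where
  "pair_step b f x y =
     ennreal (b x) * (ennreal (b y) * f (x + 1) (y + 1) + ennreal (1 - b y) * f (x + 1) (y - 1))
   + ennreal (1 - b x) * (ennreal (b y) * f (x - 1) (y + 1) + ennreal (1 - b y) * f (x - 1) (y - 1))"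

primrec meet_iter :: "(int \<Rightarrow> real) \<Rightarrow> nat \<Rightarrow> nat \<Rightarrow> int \<Rightarrow> int \<Rightarrow> ennreal" where
  "meet_iter b d 0 x y = 0"
| "meet_iter b d (Suc n) x y = (if x = y + 2 * int d then 0 else 1 + pair_step b (meet_iter b d n) x y)"

text \<open>Iterating from 0 yields the least solution of the balance equations in [0, \<infinity>],
  which is the expected meeting time.\<close>

definition meet_time :: "(int \<Rightarrow> real) \<Rightarrow> nat \<Rightarrow> int \<Rightarrow> int \<Rightarrow> ennreal" where
  "meet_time b d x y = (SUP n. meet_iter b d n x y)"

lemma signed_seq_bounds:
  assumes "a \<in> admissible"
  shows "0 \<le> signed_seq a k" "signed_seq a k \<le> 1"
  using assms by (auto simp: admissible_def signed_seq_def)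

lemma ennreal_split_one: "0 \<le> p \<Longrightarrow> p \<le> 1 \<Longrightarrow> ennreal p * c + ennreal (1 - p) * c = c"
  by (simp flip: distrib_right ennreal_plus)

lemma pair_step_one_plus:
  assumes "\<And>k. 0 \<le> b k" "\<And>k. b k \<le> 1"
  shows "pair_step b (\<lambda>x y. 1 + f x y) x y = 1 + pair_step b f x y"
proof -
  have "pair_step b (\<lambda>x y. 1 + f x y) x y =
      (ennreal (b x) * (ennreal (b y) * 1 + ennreal (1 - b y) * 1)
       + ennreal (1 - b x) * (ennreal (b y) * 1 + ennreal (1 - b y) * 1)) + pair_step b f x y"
    unfolding pair_step_def by (simp add: distrib_left add_ac)
  also have "\<dots> = 1 + pair_step b f x y"
    using assms by (simp only: ennreal_split_one)
  finally show ?thesis .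
qed

section \<open>First-step analysis of the rendezvous process and the truncated chain\<close>

lemma nn_integral_agent_step:
  assumes "a \<in> admissible"
  shows "(\<integral>\<^sup>+k. g k \<partial>measure_pmf (agent_step a x))
      = ennreal (signed_seq a x) * g (x + 1) + ennreal (1 - signed_seq a x) * g (x - 1)"
  using signed_seq_bounds[OF assms, of x]
  by (simp add: agent_step_def nn_integral_bernoulli_pmf mult.commute)

lemma nn_integral_two_chains:
  fixes f :: "int stream \<times> int stream \<Rightarrow> ennreal"
  assumes a: "a \<in> admissible"
    and f [measurable]: "f \<in> borel_measurable (stream_space (count_space UNIV) \<Otimes>\<^sub>M stream_space (count_space UNIV))"
  shows "(\<integral>\<^sup>+z. f z \<partial>(markov_chain (agent_step a) x \<Otimes>\<^sub>M markov_chain (agent_step a) y))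
    = pair_step (signed_seq a) (\<lambda>x' y'. \<integral>\<^sup>+(X, Y). f (x ## X, y ## Y)
         \<partial>(markov_chain (agent_step a) x' \<Otimes>\<^sub>M markov_chain (agent_step a) y')) x y"
proof -
  let ?S = "stream_space (count_space (UNIV :: int set))"
  let ?M = "markov_chain (agent_step a)"
  interpret M: prob_space "?M z" for z by (rule prob_space_markov_chain)
  have sets_M [measurable_cong]: "sets (?M z) = sets ?S" for z by (simp add: markov_chain_def)
  have fubini: "(\<integral>\<^sup>+z. g z \<partial>(?M x \<Otimes>\<^sub>M ?M y)) = (\<integral>\<^sup>+X. \<integral>\<^sup>+Y. g (X, Y) \<partial>?M y \<partial>?M x)"
    if [measurable]: "g \<in> borel_measurable (?S \<Otimes>\<^sub>M ?S)" for g x y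
    by (rule M.nn_integral_fst[symmetric]) measurable
  have inner: "(\<integral>\<^sup>+Y. f (X, Y) \<partial>?M y) = ennreal (signed_seq a y) * (\<integral>\<^sup>+Y. f (X, y ## Y) \<partial>?M (y + 1))
      + ennreal (1 - signed_seq a y) * (\<integral>\<^sup>+Y. f (X, y ## Y) \<partial>?M (y - 1))" if "X \<in> space ?S" for X
  proof -
    have [measurable]: "(\<lambda>Y. f (X, Y)) \<in> borel_measurable ?S" using that by measurable
    show ?thesis by (subst nn_integral_markov_chain) (simp_all add: nn_integral_agent_step[OF a])
  qed
  have "(\<integral>\<^sup>+z. f z \<partial>(?M x \<Otimes>\<^sub>M ?M y)) = (\<integral>\<^sup>+X. \<integral>\<^sup>+Y. f (X, Y) \<partial>?M y \<partial>?M x)"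
    by (rule fubini) measurable
  also have "\<dots> = ennreal (signed_seq a x) * (\<integral>\<^sup>+X. \<integral>\<^sup>+Y. f (x ## X, Y) \<partial>?M y \<partial>?M (x + 1))
      + ennreal (1 - signed_seq a x) * (\<integral>\<^sup>+X. \<integral>\<^sup>+Y. f (x ## X, Y) \<partial>?M y \<partial>?M (x - 1))"
    by (subst nn_integral_markov_chain) (simp_all add: nn_integral_agent_step[OF a])
  finally have "(\<integral>\<^sup>+z. f z \<partial>(?M x \<Otimes>\<^sub>M ?M y))
      = ennreal (signed_seq a x) * (\<integral>\<^sup>+X. \<integral>\<^sup>+Y. f (x ## X, Y) \<partial>?M y \<partial>?M (x + 1))
      + ennreal (1 - signed_seq a x) * (\<integral>\<^sup>+X. \<integral>\<^sup>+Y. f (x ## X, Y) \<partial>?M y \<partial>?M (x - 1))" .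
  moreover have "(\<integral>\<^sup>+X. \<integral>\<^sup>+Y. f (x ## X, Y) \<partial>?M y \<partial>?M x')
     = ennreal (signed_seq a y) * (\<integral>\<^sup>+(X, Y). f (x ## X, y ## Y) \<partial>(?M x' \<Otimes>\<^sub>M ?M (y + 1)))
      + ennreal (1 - signed_seq a y) * (\<integral>\<^sup>+(X, Y). f (x ## X, y ## Y) \<partial>(?M x' \<Otimes>\<^sub>M ?M (y - 1)))" for x'
  proof -
    have "(\<integral>\<^sup>+X. \<integral>\<^sup>+Y. f (x ## X, Y) \<partial>?M y \<partial>?M x') =
       (\<integral>\<^sup>+X. ennreal (signed_seq a y) * (\<integral>\<^sup>+Y. f (x ## X, y ## Y) \<partial>?M (y + 1))
      + ennreal (1 - signed_seq a y) * (\<integral>\<^sup>+Y. f (x ## X, y ## Y) \<partial>?M (y - 1)) \<partial>?M x')"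
      by (intro nn_integral_cong inner) (auto simp: space_stream_space)
    also have "\<dots> = ennreal (signed_seq a y) * (\<integral>\<^sup>+X. \<integral>\<^sup>+Y. f (x ## X, y ## Y) \<partial>?M (y + 1) \<partial>?M x')
      + ennreal (1 - signed_seq a y) * (\<integral>\<^sup>+X. \<integral>\<^sup>+Y. f (x ## X, y ## Y) \<partial>?M (y - 1) \<partial>?M x')"
      by (subst nn_integral_add) (auto simp: nn_integral_cmult)
    finally show ?thesis by (simp add: fubini)
  qed
  ultimately show ?thesis by (simp only: pair_step_def)
qed

lemma expected_rendezvous_time_eq:
  assumes a: "a \<in> admissible"
  shows "expected_rendezvous_time d a = meet_time (signed_seq a) d 0 0"
proof -
  let ?M = "markov_chain (agent_step a)"
  let ?S = "stream_space (count_space (UNIV :: int set))"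
  have sets_M [measurable_cong]: "sets (?M z) = sets ?S" for z by (simp add: markov_chain_def)
  interpret M: prob_space "?M z" for z by (rule prob_space_markov_chain)
  interpret P: prob_space "?M x \<Otimes>\<^sub>M ?M y" for x y
    by (intro prob_space_pair M.prob_space_axioms)
  let ?T = "\<lambda>n z. capped_time n (\<lambda>t. fst z !! t = snd z !! t + 2 * int d)"
  have T [measurable]: "?T n \<in> borel_measurable (?S \<Otimes>\<^sub>M ?S)" for n
    by (rule measurable_capped_time) measurable
  have "(\<integral>\<^sup>+z. ?T n z \<partial>(?M x \<Otimes>\<^sub>M ?M y)) = meet_iter (signed_seq a) d n x y" for n x y
  proof (induction n arbitrary: x y)
    case (Suc n)
    have *: "(\<integral>\<^sup>+z. 1 + ?T n z \<partial>(?M x \<Otimes>\<^sub>M ?M y)) = 1 + meet_iter (signed_seq a) d n x y" for x y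
      by (subst nn_integral_add) (simp_all add: Suc.IH P.emeasure_space_1)
    have "(\<integral>\<^sup>+z. ?T (Suc n) z \<partial>(?M x \<Otimes>\<^sub>M ?M y)) = pair_step (signed_seq a) (\<lambda>x' y'.
        \<integral>\<^sup>+z. (if x = y + 2 * int d then 0 else 1 + ?T n z) \<partial>(?M x' \<Otimes>\<^sub>M ?M y')) x y"
      by (subst nn_integral_two_chains[OF a T]) (simp add: case_prod_unfold cong: if_cong)
    also have "\<dots> = meet_iter (signed_seq a) d (Suc n) x y"
    proof (cases "x = y + 2 * int d")
      case True
      then show ?thesis by (simp add: pair_step_def)
    next
      case False
      then show ?thesis
        by (simp only: if_False * pair_step_one_plus signed_seq_bounds[OF a] meet_iter.simps)
    qed
    finally show ?case .
  qed simp
  then show ?thesis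
    unfolding expected_rendezvous_time_def meet_time_def case_prod_unfold
    by (subst nn_integral_first_time) simp_all
qed

text \<open>Freezing the pair after absorption does not affect the first hitting time, so the
  recursion is the same as for two free agents.\<close>

lemma trunc_absorption_time_eq:
  assumes a: "trunc_strategy n as \<in> admissible"
  shows "trunc_absorption_time d n as = meet_time (signed_seq (trunc_strategy n as)) d 0 0"
proof -
  let ?M = "markov_chain (trunc_step d n as)"
  let ?b = "signed_seq (trunc_strategy n as)"
  let ?S = "stream_space (count_space (UNIV :: (int \<times> int) set))"
  have sets_M [measurable_cong]: "sets (?M z) = sets ?S" for z by (simp add: markov_chain_def)
  interpret M: prob_space "?M z" for z by (rule prob_space_markov_chain)
  let ?T = "\<lambda>m \<omega>. capped_time m (\<lambda>t. fst (\<omega> !! t) - snd (\<omega> !! t) = 2 * int d)"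
  have T [measurable]: "?T m \<in> borel_measurable ?S" for m
    by (rule measurable_capped_time) measurable
  have "(\<integral>\<^sup>+\<omega>. ?T m \<omega> \<partial>?M (x, y)) = meet_iter ?b d m x y" for m x y
  proof (induction m arbitrary: x y)
    case (Suc m)
    have *: "(\<integral>\<^sup>+\<omega>. 1 + ?T m \<omega> \<partial>?M (x, y)) = 1 + meet_iter ?b d m x y" for x y
      by (subst nn_integral_add) (simp_all add: Suc.IH M.emeasure_space_1)
    have step: "(\<integral>\<^sup>+\<omega>. ?T (Suc m) \<omega> \<partial>?M (x, y)) = (\<integral>\<^sup>+z. \<integral>\<^sup>+\<omega>.
        (if x - y = 2 * int d then 0 else 1 + ?T m \<omega>) \<partial>?M z \<partial>trunc_step d n as (x, y))"
      by (subst nn_integral_markov_chain[OF T]) (simp cong: if_cong)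
    show ?case
    proof (cases "x - y = 2 * int d")
      case True
      then show ?thesis using step by simp
    next
      case False
      then have "trunc_step d n as (x, y)
          = pair_pmf (agent_step (trunc_strategy n as) x) (agent_step (trunc_strategy n as) y)"
        by (simp add: trunc_step_def)
      with False have "(\<integral>\<^sup>+\<omega>. ?T (Suc m) \<omega> \<partial>?M (x, y)) = pair_step ?b (\<lambda>x y. 1 + meet_iter ?b d m x y) x y"
        unfolding step by (simp add: nn_integral_pair_pmf' nn_integral_agent_step[OF a] * pair_step_def)
      also have "\<dots> = 1 + pair_step ?b (meet_iter ?b d m) x y"
        by (rule pair_step_one_plus) (rule signed_seq_bounds[OF a])+
      also have "\<dots> = meet_iter ?b d (Suc m) x y" using False by simp
      finally show ?thesis .
    qed
  qed simp
  then show ?thesis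
    unfolding trunc_absorption_time_def meet_time_def
    by (subst nn_integral_first_time) simp_all
qed

section \<open>Monotonicity and reflection\<close>

lemma pair_step_mono:
  assumes "\<And>x' y'. \<bar>x' - x\<bar> = 1 \<Longrightarrow> \<bar>y' - y\<bar> = 1 \<Longrightarrow> f x' y' \<le> g x' y'"
  shows "pair_step b f x y \<le> pair_step b g x y"
  unfolding pair_step_def using assms by (intro add_mono mult_left_mono) auto

lemma incseq_meet_iter: "incseq (\<lambda>n. meet_iter b d n x y)"
proof (rule incseq_SucI)
  show "meet_iter b d n x y \<le> meet_iter b d (Suc n) x y" for n
  proof (induction n arbitrary: x y)
    case (Suc n)
    show ?case
    proof (cases "x = y + 2 * int d")
      case False
      have "pair_step b (meet_iter b d n) x y \<le> pair_step b (meet_iter b d (Suc n)) x y"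
        by (intro pair_step_mono Suc.IH)
      with False show ?thesis by (simp only: meet_iter.simps if_False add_left_mono)
    qed simp
  qed simp
qed

lemma meet_time_unfold:
  "meet_time b d x y = (if x = y + 2 * int d then 0 else 1 + pair_step b (meet_time b d) x y)"
proof (cases "x = y + 2 * int d")
  case True
  then have "meet_iter b d n x y = 0" for n by (cases n) auto
  with True show ?thesis by (simp add: meet_time_def)
next
  case False
  have inc: "incseq (\<lambda>n. c * meet_iter b d n x y)" for c x y
    using incseq_meet_iter[of b d x y] by (auto simp: incseq_def intro: mult_left_mono)
  have inc2: "incseq (\<lambda>n. c * (e * meet_iter b d n x y + e' * meet_iter b d n x' y'))" for c e e' x y x' y'
    using incseq_meet_iter[of b d] by (auto simp: incseq_def intro!: mult_left_mono add_mono)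
  have "meet_time b d x y = (SUP n. meet_iter b d (Suc n) x y)"
    unfolding meet_time_def
    by (intro antisym SUP_mono) (use incseq_SucD[OF incseq_meet_iter] in blast)+
  also have "\<dots> = (SUP n. 1 + pair_step b (meet_iter b d n) x y)" using False by simp
  also have "\<dots> = 1 + (SUP n. pair_step b (meet_iter b d n) x y)"
    by (subst ennreal_SUP_add_right) auto
  also have "(SUP n. pair_step b (meet_iter b d n) x y) = pair_step b (meet_time b d) x y"
    unfolding pair_step_def meet_time_def using inc inc2
    by (simp add: ennreal_SUP_add SUP_mult_left_ennreal[symmetric])
  finally show ?thesis using False by simp
qed

text \<open>Induction on the horizon: the worst move from x + 2 and the best move from x both lead
  to x + 1, so the order survives whatever the probabilities are.\<close>

lemma meet_iter_antimono_x:
  assumes b: "\<And>k. 0 \<le> b k" "\<And>k. b k \<le> 1" and "even (x - y)" "x + 2 \<le> y + 2 * int d"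
  shows "meet_iter b d n (x + 2) y \<le> meet_iter b d n x y"
  using assms(3,4)
proof (induction n arbitrary: x y)
  case (Suc n)
  show ?case
  proof (cases "x + 2 = y + 2 * int d")
    case False
    have ne: "x \<noteq> y + 2 * int d" using Suc.prems by simp
    have mid: "ennreal (b (x + 2)) * meet_iter b d n (x + 3) y' + ennreal (1 - b (x + 2)) * meet_iter b d n (x + 1) y'
        \<le> ennreal (b x) * meet_iter b d n (x + 1) y' + ennreal (1 - b x) * meet_iter b d n (x - 1) y'"
      if y': "y' = y + 1 \<or> y' = y - 1" for y'
    proof -
      \<comment> \<open>By parity the gap is at least 2, so after any joint move the induction
        hypothesis still applies.\<close>
      have le: "x + 4 \<le> y + 2 * int d"
        using Suc.prems False by presburger
      have 1: "meet_iter b d n (x + 3) y' \<le> meet_iter b d n (x + 1) y'"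
        using Suc.IH[of "x + 1" y'] le y' Suc.prems by (auto simp: add.assoc)
      have shift: "x - 1 + 2 = x + 1" by simp
      have 2: "meet_iter b d n (x + 1) y' \<le> meet_iter b d n (x - 1) y'"
        using Suc.IH[of "x - 1" y', unfolded shift] le y' Suc.prems by auto
      have "ennreal (b (x + 2)) * meet_iter b d n (x + 3) y' + ennreal (1 - b (x + 2)) * meet_iter b d n (x + 1) y'
          \<le> ennreal (b (x + 2)) * meet_iter b d n (x + 1) y' + ennreal (1 - b (x + 2)) * meet_iter b d n (x + 1) y'"
        using 1 by (intro add_mono mult_left_mono) auto
      also have "\<dots> = ennreal (b x) * meet_iter b d n (x + 1) y' + ennreal (1 - b x) * meet_iter b d n (x + 1) y'"
        using b by (simp add: ennreal_split_one)
      also have "\<dots> \<le> ennreal (b x) * meet_iter b d n (x + 1) y' + ennreal (1 - b x) * meet_iter b d n (x - 1) y'"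
        using 2 by (intro add_mono mult_left_mono) auto
      finally show ?thesis .
    qed
    have rearr: "pair_step b f x y = ennreal (b y) * (ennreal (b x) * f (x + 1) (y + 1) + ennreal (1 - b x) * f (x - 1) (y + 1))
       + ennreal (1 - b y) * (ennreal (b x) * f (x + 1) (y - 1) + ennreal (1 - b x) * f (x - 1) (y - 1))" for f x y
      unfolding pair_step_def by (simp add: distrib_left mult_ac add_ac)
    have shifts: "x + 2 + 1 = x + 3" "x + 2 - 1 = x + 1" by simp_all
    have "pair_step b (meet_iter b d n) (x + 2) y \<le> pair_step b (meet_iter b d n) x y"
      unfolding rearr shifts by (rule add_mono[OF mult_left_mono[OF mid] mult_left_mono[OF mid]]) auto
    with False ne show ?thesis by (simp add: add_left_mono)
  qed simp
qed simp

text \<open>Exchanging the agents and reflecting the line preserves both the dynamics and the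
  meeting condition.\<close>

lemma meet_iter_reflect:
  assumes "\<And>k. b (- k) = 1 - b k"
  shows "meet_iter b d n (- y) (- x) = meet_iter b d n x y"
proof (induction n arbitrary: x y)
  case (Suc n)
  have "pair_step b (meet_iter b d n) (- y) (- x) = pair_step b (meet_iter b d n) x y"
  proof -
    have neg: "- k - 1 = - (k + 1)" "- k + 1 = - (k - 1)" for k :: int by simp_all
    have "meet_iter b d n (- y - 1) (- x - 1) = meet_iter b d n (x + 1) (y + 1)"
      "meet_iter b d n (- y + 1) (- x - 1) = meet_iter b d n (x + 1) (y - 1)"
      "meet_iter b d n (- y - 1) (- x + 1) = meet_iter b d n (x - 1) (y + 1)"
      "meet_iter b d n (- y + 1) (- x + 1) = meet_iter b d n (x - 1) (y - 1)"
      unfolding neg by (rule Suc.IH)+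
    then show ?thesis
      unfolding pair_step_def assms by (simp add: distrib_left mult_ac add_ac)
  qed
  then show ?case by (auto simp del: One_nat_def)
qed simp

lemma meet_time_antimono_x:
  assumes "\<And>k. 0 \<le> b k" "\<And>k. b k \<le> 1" "even (x - y)" "x + 2 \<le> y + 2 * int d"
  shows "meet_time b d (x + 2) y \<le> meet_time b d x y"
  unfolding meet_time_def by (intro SUP_mono) (use meet_iter_antimono_x[of b, OF assms] in blast)

lemma meet_time_reflect:
  assumes "\<And>k. b (- k) = 1 - b k"
  shows "meet_time b d (- y) (- x) = meet_time b d x y"
  using assms by (simp add: meet_time_def meet_iter_reflect)

lemma meet_time_mono_y:
  assumes "\<And>k. 0 \<le> b k" "\<And>k. b k \<le> 1" "\<And>k. b (- k) = 1 - b k" "even (x - y)" "x \<le> y + 2 * int d"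
  shows "meet_time b d x y \<le> meet_time b d x (y + 2)"
  using meet_time_antimono_x[of b "- y - 2" "- x" d]
    meet_time_reflect[of b d y x] meet_time_reflect[of b d "y + 2" x] assms
  by (simp add: algebra_simps)

section \<open>Comparison bounds and real-valued balance equations\<close>

lemma pair_step_ge:
  assumes b: "\<And>k. 0 \<le> b k" "\<And>k. b k \<le> 1"
    and u: "u \<le> f (x + 1) (y + 1)" "u \<le> f (x + 1) (y - 1)"
    and v: "v \<le> f (x - 1) (y + 1)" "v \<le> f (x - 1) (y - 1)"
  shows "ennreal (b x) * u + ennreal (1 - b x) * v \<le> pair_step b f x y"
proof -
  have "ennreal (b x) * u + ennreal (1 - b x) * v =
      ennreal (b x) * (ennreal (b y) * u + ennreal (1 - b y) * u)
      + ennreal (1 - b x) * (ennreal (b y) * v + ennreal (1 - b y) * v)"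
    using b by (simp only: ennreal_split_one)
  also have "\<dots> \<le> pair_step b f x y"
    unfolding pair_step_def using u v by (intro add_mono mult_left_mono) auto
  finally show ?thesis .
qed

text \<open>The iterates start at 0 and the operator is monotone, so none of them can pass a
  supersolution.\<close>

lemma meet_time_le_supersolution:
  assumes "\<And>x y. x \<noteq> y + 2 * int d \<Longrightarrow> 1 + pair_step b w x y \<le> w x y"
  shows "meet_time b d x y \<le> w x y"
proof -
  have "meet_iter b d n x y \<le> w x y" for n
  proof (induction n arbitrary: x y)
    case (Suc n)
    show ?case
    proof (cases "x = y + 2 * int d")
      case False
      have "1 + pair_step b (meet_iter b d n) x y \<le> 1 + pair_step b w x y"
        by (intro add_left_mono pair_step_mono Suc.IH)
      also have "\<dots> \<le> w x y" using False by (rule assms)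
      finally show ?thesis using False by simp
    qed simp
  qed simp
  then show ?thesis unfolding meet_time_def by (rule SUP_least)
qed

lemma meet_time_successors_finite:
  assumes "meet_time b d x y \<noteq> \<top>" "x \<noteq> y + 2 * int d"
  shows "0 < b x \<Longrightarrow> 0 < b y \<Longrightarrow> meet_time b d (x + 1) (y + 1) \<noteq> \<top>"
    and "0 < b x \<Longrightarrow> b y < 1 \<Longrightarrow> meet_time b d (x + 1) (y - 1) \<noteq> \<top>"
    and "b x < 1 \<Longrightarrow> 0 < b y \<Longrightarrow> meet_time b d (x - 1) (y + 1) \<noteq> \<top>"
    and "b x < 1 \<Longrightarrow> b y < 1 \<Longrightarrow> meet_time b d (x - 1) (y - 1) \<noteq> \<top>"
  using assms(1) meet_time_unfold[of b d x y] assms(2)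
  by (auto simp: pair_step_def ennreal_mult_eq_top_iff)

text \<open>An infinite successor can only carry weight 0, so its conversion by
  \<open>enn2real\<close> to 0 is harmless.\<close>

lemma enn2real_meet_time_unfold:
  assumes b: "\<And>k. 0 \<le> b k" "\<And>k. b k \<le> 1"
    and fin: "meet_time b d x y \<noteq> \<top>" and ne: "x \<noteq> y + 2 * int d"
  defines "h \<equiv> \<lambda>x y. enn2real (meet_time b d x y)"
  shows "h x y = 1 + (b x * (b y * h (x + 1) (y + 1) + (1 - b y) * h (x + 1) (y - 1))
    + (1 - b x) * (b y * h (x - 1) (y + 1) + (1 - b y) * h (x - 1) (y - 1)))"
proof -
  have "1 + pair_step b (meet_time b d) x y < \<top>"
    using fin ne meet_time_unfold[of b d x y] by (simp add: less_top)
  then have "enn2real (1 + pair_step b (meet_time b d) x y) =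
    1 + (b x * (b y * h (x + 1) (y + 1) + (1 - b y) * h (x + 1) (y - 1))
    + (1 - b x) * (b y * h (x - 1) (y + 1) + (1 - b y) * h (x - 1) (y - 1)))"
    unfolding pair_step_def h_def distrib_left using b
    by (simp add: enn2real_plus enn2real_mult)
  then show ?thesis using ne meet_time_unfold[of b d x y] by (simp add: h_def)
qed

text \<open>Let u be the infimum over the diagonal. The pair meets next with probability b(1 - b)
  \<le> 1/4; otherwise it is on the diagonal or at (k - 1, k + 1), where the time is no smaller than
  at (k + 1, k + 1). Hence u \<ge> 1 + 3 u / 4.\<close>

lemma meet_time_diag_ge_4:
  assumes b: "\<And>k. 0 \<le> b k" "\<And>k. b k \<le> 1" "\<And>k. b (- k) = 1 - b k"
  shows "4 \<le> meet_time b 1 x x"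
proof -
  define u where "u = (INF k. meet_time b 1 k k)"
  have u: "u \<le> meet_time b 1 k k" for k unfolding u_def by (rule INF_lower) simp
  have "1 + ennreal (3 / 4) * u \<le> meet_time b 1 k k" for k
  proof -
    have bk: "0 \<le> b k * (1 - b k)" "b k * (1 - b k) \<le> 1 / 4"
    proof -
      have "1 / 4 - b k * (1 - b k) = (b k - 1 / 2)^2" by (simp add: power2_eq_square field_simps)
      then show "b k * (1 - b k) \<le> 1 / 4" by (metis diff_ge_0_iff_ge zero_le_power2)
    qed (use b in simp)
    have "meet_time b 1 (k + 1) (k + 1) \<le> meet_time b 1 (k - 1) (k + 1)"
      using meet_time_antimono_x[of b "k - 1" "k + 1" 1] b by (simp add: add.commute)
    then have k: "u \<le> meet_time b 1 (k - 1) (k + 1)" using u order_trans by blast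
    have "ennreal (3 / 4) * u \<le> ennreal (b k * b k + (1 - b k) * b k + (1 - b k) * (1 - b k)) * u"
      using bk by (intro mult_right_mono ennreal_leI) (auto simp: algebra_simps)
    also have "\<dots> = ennreal (b k) * (ennreal (b k) * u + ennreal (1 - b k) * 0) + ennreal (1 - b k) * (ennreal (b k) * u + ennreal (1 - b k) * u)"
      using b by (simp add: ennreal_mult distrib_right distrib_left mult_ac add_ac)
    also have "\<dots> \<le> pair_step b (meet_time b 1) k k"
      unfolding pair_step_def using u k by (intro add_mono mult_left_mono) auto
    finally show ?thesis
      using meet_time_unfold[of b 1 k k] by (simp add: add_left_mono)
  qed
  then have "1 + ennreal (3 / 4) * u \<le> u" unfolding u_def by (intro INF_greatest)
  then have "4 \<le> u"
  proof (cases u)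
    case (real r)
    with \<open>1 + ennreal (3 / 4) * u \<le> u\<close> have "ennreal (1 + 3 / 4 * r) \<le> ennreal r"
      by (simp add: ennreal_mult[symmetric])
    with real have "4 \<le> r" by (subst (asm) ennreal_le_iff) auto
    then have "ennreal 4 \<le> ennreal r" by (rule ennreal_leI)
    with real show ?thesis by simp
  qed simp
  with u[of x] show ?thesis by simp
qed

section \<open>The optimal strategy\<close>

lemma signed_seq_minus: "a \<in> admissible \<Longrightarrow> signed_seq a (- k) = 1 - signed_seq a k"
  by (auto simp: signed_seq_def admissible_def)

text \<open>A value below V makes h(0, 0) finite. Finiteness spreads to every successor of positive
  probability, so the balance equations may be used over the reals.\<close>

lemma meet_time_lower_bound:
  assumes a: "a \<in> admissible"
    and V: "V \<le> 13 / 2" "\<And>p. 0 \<le> p \<Longrightarrow> p < 1 \<Longrightarrow> V \<le> trunc_num p / trunc_den p"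
  shows "ennreal V \<le> meet_time (signed_seq a) 1 0 0"
proof (rule ccontr)
  assume low: "\<not> ?thesis"
  define b where "b = signed_seq a"
  define p where "p = b 1"
  define q where "q = b 2"
  have b: "0 \<le> b k" "b k \<le> 1" "b (- k) = 1 - b k" for k
    using signed_seq_bounds[OF a] signed_seq_minus[OF a] by (auto simp: b_def)
  have b0: "b 0 = 1 / 2" using b(3)[of 0] by simp
  have b_simps: "b (- 1) = 1 - p" "b (- 2) = 1 - q" "b (- 3) = 1 - b 3" "b 1 = p" "b 2 = q"
    by (simp_all add: b p_def q_def)
  have pq: "0 \<le> p" "p \<le> 1" "0 \<le> q" "q \<le> 1" using b by (simp_all add: p_def q_def)
  define h where "h = meet_time b 1"
  define r where "r x y = enn2real (h x y)" for x y
  have unfold: "h x y = 1 + pair_step b h x y" if "x \<noteq> y + 2" for x y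
    using that meet_time_unfold[of b 1 x y] by (simp add: h_def)
  have fin: "0 < b x \<Longrightarrow> 0 < b y \<Longrightarrow> h (x + 1) (y + 1) \<noteq> \<top>"
    "0 < b x \<Longrightarrow> b y < 1 \<Longrightarrow> h (x + 1) (y - 1) \<noteq> \<top>"
    "b x < 1 \<Longrightarrow> 0 < b y \<Longrightarrow> h (x - 1) (y + 1) \<noteq> \<top>"
    "b x < 1 \<Longrightarrow> b y < 1 \<Longrightarrow> h (x - 1) (y - 1) \<noteq> \<top>"
    if "h x y \<noteq> \<top>" "x \<noteq> y + 2" for x y
    using meet_time_successors_finite[of b 1 x y] that by (simp_all add: h_def)
  have r_unfold: "r x y = 1 + (b x * (b y * r (x + 1) (y + 1) + (1 - b y) * r (x + 1) (y - 1))
      + (1 - b x) * (b y * r (x - 1) (y + 1) + (1 - b y) * r (x - 1) (y - 1)))"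
    if "h x y \<noteq> \<top>" "x \<noteq> y + 2" for x y
    using enn2real_meet_time_unfold[of b 1 x y] that b by (simp add: h_def r_def)
  have r_hit: "r x y = 0" if "x = y + 2" for x y
    using that meet_time_unfold[of b 1 x y] by (simp add: r_def h_def)
  have mono_x: "h (x + 2) y \<le> h x y" if "even (x - y)" "x \<le> y" for x y
    using meet_time_antimono_x[of b x y 1] b that by (simp add: h_def)
  have mono_y: "h x y \<le> h x (y + 2)" if "even (x - y)" "x \<le> y + 2" for x y
    using meet_time_mono_y[of b x y 1] b that by (simp add: h_def)
  have reflect: "h (- y) (- x) = h x y" for x y
    unfolding h_def using b by (intro meet_time_reflect)
  have refl_r: "r (- 1) (- 1) = r 1 1" "r (- 2) 0 = r 0 2" "r (- 3) 1 = r (- 1) 3"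
    using reflect[of 1 1] reflect[of 2 0] reflect[of 3 "- 1"] by (simp_all add: r_def)

  have fin00: "h 0 0 \<noteq> \<top>" using low by (auto simp: h_def b_def)
  then have h00: "h 0 0 = ennreal (r 0 0)" by (simp add: r_def less_top)
  have below: "r 0 0 < V"
  proof -
    have "ennreal (r 0 0) < ennreal V" using low unfolding h00[symmetric] h_def b_def by (simp only: not_le)
    then show ?thesis by (simp add: ennreal_less_iff r_def)
  qed
  have fin11: "h 1 1 \<noteq> \<top>" and finm11: "h (- 1) 1 \<noteq> \<top>"
    using fin[OF fin00] b0 by simp_all
  have A: "r 0 0 = 1 + r (- 1) 1 / 4 + r 1 1 / 2"
    using r_unfold[OF fin00] by (simp add: b0 refl_r r_hit field_simps)
  have B: "r 1 1 = 1 + p * (1 - p) * r 0 2 + p^2 * r 2 2 + (1 - p)^2 * r 0 0"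
    using r_unfold[OF fin11] by (simp add: b_simps r_hit power2_eq_square algebra_simps)
  have C: "r (- 1) 1 = 1 + (1 - p)^2 * r 0 0 + p^2 * r (- 2) 2 + 2 * p * (1 - p) * r 0 2"
    using r_unfold[OF finm11] by (simp add: b_simps refl_r power2_eq_square algebra_simps)
  have BC: "r 1 1 \<le> r (- 1) 1"
    using mono_x[of "- 1" 1] finm11 by (auto simp: r_def less_top intro: enn2real_mono)

  show False
  \<comment> \<open>For p = 0 the equations close up on A, B, C and give A = 7.\<close>
  proof (cases "p = 0")
    case True
    then have "r 0 0 = 7" using A B C by (simp add: field_simps)
    with below V(1) show False by simp
  next
    case False
    then have p0: "0 < p" using pq by simp
    have finm22: "h (- 2) 2 \<noteq> \<top>" and fin22: "h 2 2 \<noteq> \<top>"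
      using fin[OF finm11] fin[OF fin11] p0 by (simp_all add: b_simps)
    \<comment> \<open>By monotonicity every successor of (-2, 2) takes at least as long as (-1,
      1).\<close>
    have "1 + h (- 1) 1 \<le> h (- 2) 2"
    proof -
      have "h (- 1) 1 \<le> h (- 1) 3" "h (- 1) 3 \<le> h (- 3) 3" "h (- 1) 1 \<le> h (- 3) 1"
        using mono_y[of "- 1" 1] mono_x[of "- 3" 3] mono_x[of "- 3" 1] by simp_all
      then have "ennreal (b (- 2)) * h (- 1) 1 + ennreal (1 - b (- 2)) * h (- 1) 1 \<le> pair_step b h (- 2) 2"
        using b by (intro pair_step_ge) auto
      then have "h (- 1) 1 \<le> pair_step b h (- 2) 2" by (simp only: ennreal_split_one b(1,2))
      then show ?thesis using unfold[of "- 2" 2] by (simp add: add_left_mono)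
    qed
    then have F: "1 + r (- 1) 1 \<le> r (- 2) 2"
      using enn2real_mono[of "1 + h (- 1) 1" "h (- 2) 2"] finm11 finm22
      by (simp add: r_def less_top enn2real_plus)
    show False
    \<comment> \<open>For p = 1 the pair at (-1, 1) moves to (-2, 2) for certain, so C \<ge> 2 +
      C.\<close>
    proof (cases "p = 1")
      case True
      with C F show False by simp
    next
      case False
      then have p1: "p < 1" using pq by simp
      have fin02: "h 0 2 \<noteq> \<top>" using fin(3)[OF fin11] p0 p1 by (simp add: b_simps)
      have D: "r 0 2 = 1 + (1 - q) / 2 * (r 1 1 + r (- 1) 1) + q / 2 * (r 1 3 + r (- 1) 3)"
        using r_unfold[OF fin02] by (simp add: b_simps b0 field_simps)
      have E: "r 2 2 = 1 + (1 - q)^2 * r 1 1 + q * (1 - q) * r 1 3 + q^2 * r 3 3"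
        using r_unfold[OF fin22] by (simp add: b_simps r_hit power2_eq_square algebra_simps)
      define g where "g = r 0 2 - 1 - (r 1 1 + r (- 1) 1) / 2"
      define e where "e = 1 + r 1 1 - r 2 2"
      have eg: "e \<le> q * (r 1 1 - 4 * q) \<and> q / 2 * (4 - p * e) \<le> g"
      \<comment> \<open>For q = 0 the outer states have weight 0 and their finiteness is not
        guaranteed; here e = g = 0.\<close>
      proof (cases "q = 0")
        case True
        then show ?thesis using D E by (simp add: e_def g_def)
      next
        case False
        then have q0: "0 < q" using pq by simp
        have fin13: "h 1 3 \<noteq> \<top>" and finm13: "h (- 1) 3 \<noteq> \<top>" and fin33: "h 3 3 \<noteq> \<top>"
          using fin[OF fin02] fin[OF fin22] q0 b0 by (simp_all add: b_simps)
        have "4 \<le> h 3 3" unfolding h_def by (rule meet_time_diag_ge_4) (rule b)+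
        then have I: "4 \<le> r 3 3"
          using enn2real_mono[of 4 "h 3 3"] fin33 by (simp add: r_def less_top)
        have G1: "r 1 1 \<le> r 1 3"
          using mono_y[of 1 1] fin13 by (auto simp: r_def less_top intro: enn2real_mono)
        have H1: "r (- 1) 1 \<le> r (- 1) 3"
          using mono_y[of "- 1" 1] finm13 by (auto simp: r_def less_top intro: enn2real_mono)
        \<comment> \<open>Bounding by the smaller outcome of y removes the unknown probability
          \<open>b 3\<close>.\<close>
        have "h 2 2 \<le> h 2 4" "h 0 2 \<le> h 0 4" "h (- 2) 2 \<le> h (- 2) 4"
          using mono_y[of 2 2] mono_y[of 0 2] mono_y[of "- 2" 2] by simp_all
        then have "ennreal (b 1) * h 2 2 + ennreal (1 - b 1) * h 0 2 \<le> pair_step b h 1 3"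
          "ennreal (b (- 1)) * h 0 2 + ennreal (1 - b (- 1)) * h (- 2) 2 \<le> pair_step b h (- 1) 3"
          by (intro pair_step_ge b(1,2); simp)+
        then have "1 + (ennreal p * h 2 2 + ennreal (1 - p) * h 0 2) \<le> h 1 3"
          "1 + (ennreal (1 - p) * h 0 2 + ennreal p * h (- 2) 2) \<le> h (- 1) 3"
          using unfold[of 1 3] unfold[of "- 1" 3] by (simp_all add: b_simps add_left_mono)
        moreover have "h 2 2 = ennreal (r 2 2)" "h 0 2 = ennreal (r 0 2)" "h (- 2) 2 = ennreal (r (- 2) 2)"
          "h 1 3 = ennreal (r 1 3)" "h (- 1) 3 = ennreal (r (- 1) 3)"
          using fin22 fin02 finm22 fin13 finm13 by (simp_all add: r_def less_top)
        moreover have "0 \<le> r x y" for x y by (simp add: r_def)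
        ultimately have "1 + p * r 2 2 + (1 - p) * r 0 2 \<le> r 1 3"
          "1 + (1 - p) * r 0 2 + p * r (- 2) 2 \<le> r (- 1) 3"
          using pq by (simp_all add: add.assoc flip: ennreal_mult ennreal_plus ennreal_1)
        from outer_correction_bounds[OF pq D E F I G1 this(1) H1 this(2)]
        show ?thesis by (simp add: e_def g_def)
      qed
      have "trunc_num p / trunc_den p \<le> r 0 0 \<or> 13 / 2 \<le> r 0 0"
      proof (rule rendezvous_lower_bound[OF p0 p1 pq(3,4) A B[symmetric, THEN eq_refl] C[symmetric, THEN eq_refl]])
        show "1 + (r 1 1 + r (- 1) 1) / 2 + g \<le> r 0 2" by (simp add: g_def)
        show "1 + r 1 1 - e \<le> r 2 2" by (simp add: e_def)
      qed (use F BC eg in auto)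
      with below V pq p1 show False by fastforce
    qed
  qed
qed

text \<open>An explicit solution of the balance equations for q = 0 is a supersolution, hence an
  upper bound.\<close>

lemma meet_time_trunc_le:
  assumes p: "0 < p" "p < 1"
  shows "meet_time (signed_seq (trunc_strategy 2 [p])) 1 0 0 \<le> ennreal (trunc_num p / trunc_den p)"
proof -
  define b where "b = signed_seq (trunc_strategy 2 [p])"
  define A where "A = trunc_num p / trunc_den p"
  \<comment> \<open>D is the equality case of the bound obtained from B + C; B and C then solve 4 A
    = 4 + 2 B + C and 2 D = 2 + B + C.\<close>
  define D where "D = (4 + 2 * (1 - p)^2 * A) / ((1 - p) * (2 - p))"
  define B where "B = 4 * A - 2 * D - 2"
  define C where "C = 4 * D - 4 * A"
  \<comment> \<open>The value \<open>b 0\<close> stays opaque until the inequalities have been moved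
    to the reals.\<close>
  define half :: real where "half = 1 / 2"
  have half: "0 < half" "half < 1" by (simp_all add: half_def)
  have b: "b 0 = half" "b 1 = p" "b (- 1) = 1 - p" "b 2 = 0" "b (- 2) = 1"
    by (simp_all add: b_def half_def signed_seq_def trunc_strategy_def)
  have den: "0 < trunc_den p" using p by (intro trunc_den_pos) auto
  have A: "A * ((1 - p) * (2 + 5 * p + p^2)) = 14 + 9 * p - 2 * p^2 + p^3"
    using den by (simp add: A_def trunc_num_def flip: trunc_den_def)
  have D: "D * ((1 - p) * (2 - p)) = 4 + 2 * (1 - p)^2 * A"
    using p by (simp add: D_def)
  have "p^2 \<le> 1" "0 \<le> p^3" using p by (auto intro: power_le_one)
  then have "0 \<le> trunc_num p" using p by (simp add: trunc_num_def)
  then have A0: "0 \<le> A" using den by (simp add: A_def)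
  have D0: "0 \<le> D" unfolding D_def using p A0 by (intro divide_nonneg_nonneg add_nonneg_nonneg mult_nonneg_nonneg) auto
  have "(2 - p) * (B * (1 - p^2)) = (2 - p) * (1 + p^2 + p * (1 - p) * D + (1 - p)^2 * A)"
    using A D unfolding B_def by algebra
  then have B: "B * (1 - p^2) = 1 + p^2 + p * (1 - p) * D + (1 - p)^2 * A" using p by simp
  have "(2 - p) * (C * (1 - p^2)) = (2 - p) * (1 + p^2 + (1 - p)^2 * A + 2 * p * (1 - p) * D)"
    using A D unfolding C_def by algebra
  then have C: "C * (1 - p^2) = 1 + p^2 + (1 - p)^2 * A + 2 * p * (1 - p) * D" using p by simp
  have p2: "0 < 1 - p^2" using p by (simp add: power_less_one_iff abs_square_less_1)
  have B0: "0 \<le> B"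
  proof -
    have "0 \<le> B * (1 - p^2)" unfolding B using p A0 D0 by auto
    with p2 show ?thesis by (simp add: zero_le_mult_iff)
  qed
  have C0: "0 \<le> C"
  proof -
    have "0 \<le> C * (1 - p^2)" unfolding C using p A0 D0 by auto
    with p2 show ?thesis by (simp add: zero_le_mult_iff)
  qed
  \<comment> \<open>Outside the states reachable from (0, 0) the value \<top> makes the
    supersolution condition trivial; transitions to such states from the listed ones have weight
    0.\<close>
  define w :: "int \<Rightarrow> int \<Rightarrow> ennreal" where "w x y =
     (if x = y + 2 then 0
      else if (x, y) = (0, 0) then ennreal A
      else if (x, y) \<in> {(1, 1), (- 1, - 1)} then ennreal B
      else if (x, y) = (- 1, 1) then ennreal C
      else if (x, y) \<in> {(0, 2), (- 2, 0)} then ennreal D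
      else if (x, y) \<in> {(2, 2), (- 2, - 2)} then ennreal (1 + B)
      else if (x, y) = (- 2, 2) then ennreal (1 + C)
      else \<top>)" for x y
  have eqs1: "1 + (C / 4 + B / 2) = A" "1 + (B / 2 + C / 2) = D"
    unfolding B_def C_def by (simp_all add: field_simps)
  have eqs2: "1 + p * (1 - p) * D + p^2 * (1 + B) + (1 - p)^2 * A = B"
    "1 + (1 - p)^2 * A + p^2 * (1 + C) + 2 * p * (1 - p) * D = C"
    using B C by (simp_all add: algebra_simps)
  have "1 + pair_step b w x y \<le> w x y" if "x \<noteq> y + 2 * int 1" for x y
  proof (cases "w x y = \<top>")
    case False
    with that consider "(x, y) = (0, 0)" | "(x, y) = (1, 1)" | "(x, y) = (- 1, - 1)" | "(x, y) = (- 1, 1)"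
      | "(x, y) = (0, 2)" | "(x, y) = (- 2, 0)" | "(x, y) = (2, 2)" | "(x, y) = (- 2, - 2)" | "(x, y) = (- 2, 2)"
      unfolding w_def by (auto split: if_splits)
    then show ?thesis
      by cases (use p half A0 B0 C0 D0 in \<open>simp_all add: pair_step_def w_def b ennreal_mult[symmetric]
          ennreal_plus[symmetric] ennreal_1[symmetric] del: ennreal_plus ennreal_1\<close>,
        use eqs1 eqs2 in \<open>simp_all add: half_def power2_eq_square algebra_simps\<close>)
  qed simp
  then have "meet_time b 1 0 0 \<le> w 0 0" by (intro meet_time_le_supersolution) auto
  then show ?thesis by (simp add: w_def A_def b_def)
qed

theorem theorem1:
  shows "\<exists>a1 :: real.
    {x \<in> {0<..<1}. - 12 + 52 * x + 39 * x^2 + 12 * x^3 - 3 * x^4 = 0} = {a1} \<and>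
    \<bar>a1 - 0.1992570042\<bar> \<le> 0.00000000005 \<and>
    optimal_rendezvous_time 1 = trunc_absorption_time 1 2 [a1] \<and>
    trunc_strategy 2 [a1] \<in> admissible \<and>
    expected_rendezvous_time 1 (trunc_strategy 2 [a1]) = optimal_rendezvous_time 1 \<and>
    optimal_rendezvous_time 1 < \<infinity> \<and>
    \<bar>enn2real (optimal_rendezvous_time 1) - 6.4670988308\<bar> \<le> 0.00000000005"
proof -
  obtain s where root: "{x \<in> {0<..<1}. crit x = 0} = {s}" and s: "\<bar>s - 0.1992570042\<bar> \<le> 0.00000000005"
    by (rule crit_root)
  from root have s01: "0 < s" "s < 1" "crit s = 0" by auto
  let ?V = "trunc_num s / trunc_den s"
  note V = trunc_ratio_numeric[OF s]
  \<comment> \<open>The minimum lies below 13/2, so the alternative bound 13/2 is strong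
    enough.\<close>
  have "0 \<le> r \<and> r \<le> 13 / 2" if "\<bar>r - 6.4670988308\<bar> \<le> 0.00000000005" for r :: real
    using that by (auto simp: abs_real_def split: if_splits)
  from this[OF V] have V_bounds: "0 \<le> ?V" "?V \<le> 13 / 2" by blast+
  have adm: "trunc_strategy 2 [s] \<in> admissible"
    using s01 by (intro trunc_strategy_admissible) auto
  have lower: "ennreal ?V \<le> expected_rendezvous_time 1 a" if "a \<in> admissible" for a
    unfolding expected_rendezvous_time_eq[OF that] using that V_bounds s01
    by (intro meet_time_lower_bound trunc_ratio_minimal) auto
  have eq: "expected_rendezvous_time 1 (trunc_strategy 2 [s]) = ennreal ?V"
    using meet_time_trunc_le[OF s01(1,2)] lower[OF adm] by (simp add: expected_rendezvous_time_eq[OF adm] antisym)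
  have opt: "optimal_rendezvous_time 1 = ennreal ?V"
    unfolding optimal_rendezvous_time_def
    by (intro antisym INF_lower2[OF adm] INF_greatest lower) (simp only: eq)
  have "trunc_absorption_time 1 2 [s] = ennreal ?V"
    using eq by (simp only: trunc_absorption_time_eq[OF adm] expected_rendezvous_time_eq[OF adm])
  with root s adm eq opt V V_bounds show ?thesis
    unfolding crit_def by (intro exI[of _ s]) simp
qed

end
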